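(* Assume that (A1) and (A2) (both stated in the context) hold, and that $B$ admits a uniformly bounded second order flat derivative in its measure argument (as defined in the context). Then there exists a constant $0<\beta<\infty$ such that for all $0<T_0<T<\infty$, all $0<\delta<\infty$, all integers $p\ge1$, all $N\ge1$ and all $1\le i\le N$, $$\mathbb{E}_{\mathbb{P}}\left[\left(\int_{T_0}^{(T_0+\delta)\wedge T}\left|\triangle B^{i,N}_t\right|^2dt\right)^p\right]\le\frac{p!\,\beta^p\delta^p}{N^p},$$ where $$\triangle B^{i,N}_t=B\big(t,X^{i,\infty};\overline\mu^{N,\infty}_t\big)-B\big(t,X^{i,\infty};\mathcal{L}((X^{i,\infty}_r)_{0\le r\le t})\big),\qquad\overline\mu^{N,\infty}_t=\frac1N\sum_{j=1}^N\delta_{\{(X^{j,\infty}_r)_{0\le r\le t}\}}.$$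
   Context: Setting. Let $d,m\ge 1$ be integers. $\mathcal{C}([0,T];\mathbb{R}^d)$ is the space of continuous functions with the uniform norm, $\mathcal{P}(E)$ is the set of Borel probability measures on $E$, and $\mathcal{L}(\cdot)$ denotes the law of a random variable. Let $$c:[0,\infty)\times\mathcal{C}([0,\infty);\mathbb{R}^d)\to\mathbb{R}^d,\quad A:[0,\infty)\times\mathcal{C}([0,\infty);\mathbb{R}^d)\to\mathbb{R}^{d\times m},\quad B:[0,\infty)\times\mathcal{C}([0,\infty);\mathbb{R}^d)\times\mathcal{P}(\mathcal{C}([0,\infty);\mathbb{R}^d))\to\mathbb{R}^m$$ be progressively measurable and non-anticipative: $c(t,x)$ and $A(t,x)$ depend on the path $x$ only through $(x_{\theta\wedge t})_{\theta\ge 0}$, and $B(t,x;P)$ depends on $x$ only through $(x_{\theta\wedge t})_{\theta\ge0}$ and on $P$ only through its image under $\omega\mapsto(\omega_{\theta\wedge t})_{\theta\ge0}$. Hence for $t\le T$ these make sense when $x$ is a path on $[0,t]$ or $[0,T]$ and $P$ is a probability measure on paths on $[0,t]$ or $[0,T]$ (equivalently one uses the stopped paths). Write $(AB)(t,x;P)=A(t,x)B(t,x;P)$. McKean SDE. Given $\mu^0\in\mathcal{P}(\mathbb{R}^d)$ and an $m$-dimensional standard Brownian motion $W$ independent of $X_0\sim\mu^0$: $$X_t=X_0+\int_0^tc(s,X)\,ds+\int_0^tA(s,X)\Big(B\big(s,X;\mathcal{L}((X_r)_{0\le r\le s})\big)ds+dW_s\Big),\quad 0\le t\le T. \qquad (M)$$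 Particle system. Given i.i.d. pairs $(\widetilde X^i_0,\widetilde W^i)$, $1\le i\le N$, distributed as $(X_0,W)$, on a filtered probability space $(\widetilde\Omega,\widetilde{\mathcal F},(\widetilde{\mathcal F}_t),\widetilde{\mathbb P})$: $$X^{i,N}_t=\widetilde X^i_0+\int_0^tc(s,X^{i,N})\,ds+\int_0^tA(s,X^{i,N})\Big(B\big(s,X^{i,N};\overline\mu^{N,N}_s\big)ds+d\widetilde W^i_s\Big),\quad \overline\mu^{N,N}_s=\frac1N\sum_{j=1}^N\delta_{\{(X^{j,N}_r)_{0\le r\le s}\}},\quad 1\le i\le N. \qquad (P)$$ (A1) For any $\mu^0$ and $0<T<\infty$, (M) admits a unique weak solution, and it satisfies a.s. $\int_0^T|(AB)(s,X;\mathcal{L}((X_r)_{0\le r\le s}))|^2ds<\infty$. (A2) For any $\mu^0$, $0<T<\infty$ and $N\ge1$, (P) admits a unique weak solution, and it satisfies a.s., for all $1\le i\le N$, $\int_0^T|(AB)(s,X^{i,N};\overline\mu^{N,N}_s)|^2ds<\infty$. Limit system. Under (A1), on a filtered probability space $(\Omega,\mathcal F,(\mathcal F_t),\mathbb P)$ carrying i.i.d. pairs $(X^i_0,W^i)$ distributed as $(X_0,W)$, $X^{1,\infty},\dots,X^{N,\infty}$ are $N$ independent copies of the solution of (M), $X^{i,\infty}$ being driven by $W^i$ and started from $X^i_0\sim\mu^0$. Uniformly bounded second order flat derivative. $B=(B^{(1)},\dots,B^{(m)})$ is said to have this property if for every $1\le l\le m$ and $0<T<\infty$ there exist measurable functionals,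 bounded by a constant independent of $T$ and of all arguments, $$\frac{dB^{(l)}}{dm}:[0,T]\times\mathcal C([0,T];\mathbb R^d)\times\mathcal P(\mathcal C([0,T];\mathbb R^d))\times\mathcal C([0,T];\mathbb R^d)\to\mathbb R,$$ $$\frac{d^2B^{(l)}}{dm^2}:[0,T]\times\mathcal C([0,T];\mathbb R^d)\times\mathcal P(\mathcal C([0,T];\mathbb R^d))\times\mathcal C([0,T];\mathbb R^d)\times\mathcal C([0,T];\mathbb R^d)\to\mathbb R,$$ such that for all $0\le t\le T$, $x,\omega\in\mathcal C([0,T];\mathbb R^d)$ and $P,Q\in\mathcal P(\mathcal C([0,T];\mathbb R^d))$, $$B^{(l)}(t,x;Q)-B^{(l)}(t,x;P)=\int_0^1\int_{\mathcal C([0,T];\mathbb R^d)}\frac{dB^{(l)}}{dm}\big(t,x,(1-\alpha)P+\alpha Q;\omega'\big)\,(Q-P)(d\omega')\,d\alpha,$$ $$\frac{dB^{(l)}}{dm}(t,x,Q;\omega)-\frac{dB^{(l)}}{dm}(t,x,P;\omega)=\int_0^1\int_{\mathcal C([0,T];\mathbb R^d)}\frac{d^2B^{(l)}}{dm^2}\big(t,x,(1-\alpha)P+\alpha Q;\omega,\tilde\omega\big)\,(Q-P)(d\tilde\omega)\,d\alpha.$$ *)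

theory Defs
  imports "HOL-Probability.Probability"
begin

section \<open>Path spaces and measures on them\<close>

text \<open>
  A path on a time set \<open>I\<close> is a continuous function on \<open>I\<close>, made extensional so that it is determined
  by its values on \<open>I\<close>.  The topology is that of uniform convergence on compact subsets of \<open>I\<close>;
  for \<open>I = {0..T}\<close> this is the topology of the uniform norm.
\<close>

type_synonym 'v path = "real \<Rightarrow> 'v"

definition paths :: "real set \<Rightarrow> ('v::metric_space) path set" where
  "paths I = {x \<in> extensional I. continuous_on I x}"

definition open_paths :: "real set \<Rightarrow> ('v::metric_space) path set \<Rightarrow> bool" where
  "open_paths I U \<longleftrightarrow> U \<subseteq> paths I \<and>
     (\<forall>x\<in>U. \<exists>K e. compact K \<and> K \<subseteq> I \<and> 0 < e \<and>
        (\<forall>y\<in>paths I. (\<forall>s\<in>K. dist (x s) (y s) < e) \<longrightarrow> y \<in> U))"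

definition path_space :: "real set \<Rightarrow> ('v::metric_space) path measure" where
  "path_space I = sigma (paths I) {U. open_paths I U}"

text \<open>The convex combination \<open>(1 - \<alpha>) P + \<alpha> Q\<close>.\<close>

definition mix_measure :: "real \<Rightarrow> 'a measure \<Rightarrow> 'a measure \<Rightarrow> 'a measure" where
  "mix_measure \<alpha> P Q = measure_of (space P) (sets P)
     (\<lambda>U. ennreal (1 - \<alpha>) * emeasure P U + ennreal \<alpha> * emeasure Q U)"

lemma emeasure_mix_measure:
  assumes "sets Q = sets P" "U \<in> sets P"
  shows "emeasure (mix_measure \<alpha> P Q) U = ennreal (1 - \<alpha>) * emeasure P U + ennreal \<alpha> * emeasure Q U"
  unfolding mix_measure_def
proof (rule emeasure_measure_of_sigma)
  show "countably_additive (sets P)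
          (\<lambda>U. ennreal (1 - \<alpha>) * emeasure P U + ennreal \<alpha> * emeasure Q U)"
  proof (rule countably_additiveI)
    fix S :: "nat \<Rightarrow> _"
    assume S: "range S \<subseteq> sets P" "disjoint_family S"
    show "(\<Sum>n. ennreal (1 - \<alpha>) * emeasure P (S n) + ennreal \<alpha> * emeasure Q (S n)) =
          ennreal (1 - \<alpha>) * emeasure P (\<Union>(range S)) + ennreal \<alpha> * emeasure Q (\<Union>(range S))"
      using S assms(1) by (simp add: suminf_add[symmetric] suminf_emeasure)
  qed
qed (use assms in \<open>auto simp: positive_def sets.sigma_algebra_axioms\<close>)

definition empirical_measure :: "'a measure \<Rightarrow> nat \<Rightarrow> (nat \<Rightarrow> 'a) \<Rightarrow> 'a measure" where
  "empirical_measure S N y = measure_of (space S) (sets S)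
     (\<lambda>U. (\<Sum>j=1..N. emeasure (return S (y j)) U) / of_nat N)"

lemma emeasure_empirical_measure:
  assumes "U \<in> sets S"
  shows "emeasure (empirical_measure S N y) U = (\<Sum>j=1..N. emeasure (return S (y j)) U) / of_nat N"
  unfolding empirical_measure_def
proof (rule emeasure_measure_of_sigma)
  show "countably_additive (sets S) (\<lambda>U. (\<Sum>j=1..N. emeasure (return S (y j)) U) / of_nat N)"
  proof (rule countably_additiveI)
    fix V :: "nat \<Rightarrow> _"
    assume V: "range V \<subseteq> sets S" "disjoint_family V"
    show "(\<Sum>n. (\<Sum>j=1..N. emeasure (return S (y j)) (V n)) / of_nat N) =
          (\<Sum>j=1..N. emeasure (return S (y j)) (\<Union>(range V))) / of_nat N"
      using V by (simp add: ennreal_suminf_divide suminf_sum suminf_emeasure del: emeasure_return)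
  qed
qed (use assms in \<open>auto simp: positive_def sets.sigma_algebra_axioms\<close>)

definition law_upto :: "'w measure \<Rightarrow> ('w \<Rightarrow> ('v::metric_space) path) \<Rightarrow> real \<Rightarrow> 'v path measure" where
  "law_upto M X s = distr M (path_space {0..s}) (\<lambda>\<omega>. restrict (X \<omega>) {0..s})"

definition empirical_upto ::
  "nat \<Rightarrow> (nat \<Rightarrow> 'w \<Rightarrow> ('v::metric_space) path) \<Rightarrow> 'w \<Rightarrow> real \<Rightarrow> 'v path measure" where
  "empirical_upto N X \<omega> s =
     empirical_measure (path_space {0..s}) N (\<lambda>j. restrict (X j \<omega>) {0..s})"


section \<open>Coefficients\<close>

text \<open>
  The coefficients take paths (and laws of paths) on any of the time sets \<open>[0,\<infinity>)\<close> and \<open>[0,T]\<close>.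
  Non-anticipativity says that at time \<open>t\<close> only the restriction of the path and the image of the law
  under restriction to \<open>[0,t]\<close> matter.  Since restriction to \<open>[0,t]\<close> and the stopped path
  \<open>\<theta> \<mapsto> x (min \<theta> t)\<close> determine each other, for the time set \<open>[0,\<infinity>)\<close> this is the usual condition, and for \<open>[0,T]\<close>
  it fixes the meaning of a coefficient at a path of finite length.  For the same reason, joint
  measurability on \<open>[0,T] \<times> C([0,T])\<close> for every \<open>T\<close> is progressive measurability.
\<close>

definition horizons :: "real set set" where
  "horizons = insert {0..} {{0..T} |T. 0 \<le> T}"

definition path_coefficient ::
  "(real \<Rightarrow> ('v::metric_space) path \<Rightarrow> 'b::topological_space) \<Rightarrow> bool" where
  "path_coefficient f \<longleftrightarrow>
     (\<forall>I\<in>horizons. \<forall>t\<in>I. \<forall>x\<in>paths I. f t x = f t (restrict x {0..t})) \<and>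
     (\<forall>T\<ge>0. (\<lambda>(t, x). f t x) \<in> restrict_space borel {0..T} \<Otimes>\<^sub>M path_space {0..T} \<rightarrow>\<^sub>M borel)"

definition path_law_coefficient ::
  "(real \<Rightarrow> ('v::metric_space) path \<Rightarrow> 'v path measure \<Rightarrow> 'b::topological_space) \<Rightarrow> bool" where
  "path_law_coefficient f \<longleftrightarrow>
     (\<forall>I\<in>horizons. \<forall>J\<in>horizons. \<forall>t\<in>I \<inter> J. \<forall>x\<in>paths I. \<forall>P\<in>space (prob_algebra (path_space J)).
        f t x P = f t (restrict x {0..t}) (distr P (path_space {0..t}) (\<lambda>\<omega>. restrict \<omega> {0..t}))) \<and>
     (\<forall>T\<ge>0. (\<lambda>(t, x, P). f t x P)
        \<in> restrict_space borel {0..T} \<Otimes>\<^sub>M path_space {0..T} \<Otimes>\<^sub>M prob_algebra (path_space {0..T})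
          \<rightarrow>\<^sub>M borel)"

definition bounded_second_flat_derivative ::
  "(real \<Rightarrow> ('v::metric_space) path \<Rightarrow> 'v path measure \<Rightarrow> real^'m) \<Rightarrow> bool" where
  "bounded_second_flat_derivative B \<longleftrightarrow>
     (\<exists>K. \<forall>l. \<forall>T>0. \<exists>D D2.
        (\<lambda>(t, x, P, \<omega>). D t x P \<omega>)
          \<in> restrict_space borel {0..T} \<Otimes>\<^sub>M path_space {0..T} \<Otimes>\<^sub>M prob_algebra (path_space {0..T})
             \<Otimes>\<^sub>M path_space {0..T} \<rightarrow>\<^sub>M borel \<and>
        (\<lambda>(t, x, P, \<omega>, \<omega>'). D2 t x P \<omega> \<omega>')
          \<in> restrict_space borel {0..T} \<Otimes>\<^sub>M path_space {0..T} \<Otimes>\<^sub>M prob_algebra (path_space {0..T})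
             \<Otimes>\<^sub>M path_space {0..T} \<Otimes>\<^sub>M path_space {0..T} \<rightarrow>\<^sub>M borel \<and>
        (\<forall>t\<in>{0..T}. \<forall>x\<in>paths {0..T}. \<forall>P\<in>space (prob_algebra (path_space {0..T})).
           \<forall>\<omega>\<in>paths {0..T}. \<forall>\<omega>'\<in>paths {0..T}. \<bar>D t x P \<omega>\<bar> \<le> K \<and> \<bar>D2 t x P \<omega> \<omega>'\<bar> \<le> K) \<and>
        (\<forall>t\<in>{0..T}. \<forall>x\<in>paths {0..T}. \<forall>\<omega>\<in>paths {0..T}.
           \<forall>P\<in>space (prob_algebra (path_space {0..T})). \<forall>Q\<in>space (prob_algebra (path_space {0..T})).
             B t x Q $ l - B t x P $ l =
               (LINT \<alpha>:{0..1}|lborel.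
                  (\<integral>\<omega>'. D t x (mix_measure \<alpha> P Q) \<omega>' \<partial>Q) - (\<integral>\<omega>'. D t x (mix_measure \<alpha> P Q) \<omega>' \<partial>P)) \<and>
             D t x Q \<omega> - D t x P \<omega> =
               (LINT \<alpha>:{0..1}|lborel.
                  (\<integral>\<omega>'. D2 t x (mix_measure \<alpha> P Q) \<omega> \<omega>' \<partial>Q) -
                  (\<integral>\<omega>'. D2 t x (mix_measure \<alpha> P Q) \<omega> \<omega>' \<partial>P))))"


section \<open>Brownian motion and the stochastic integral\<close>

definition filtered_prob_space :: "'w measure \<Rightarrow> (real \<Rightarrow> 'w measure) \<Rightarrow> bool" where
  "filtered_prob_space M F \<longleftrightarrow>
     prob_space M \<and> filtration (space M) F \<and> (\<forall>t. sets (F t) \<subseteq> sets M)"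

definition continuous_adapted ::
  "'w measure \<Rightarrow> (real \<Rightarrow> 'w measure) \<Rightarrow> real \<Rightarrow> ('w \<Rightarrow> ('v::metric_space) path) \<Rightarrow> bool" where
  "continuous_adapted M F T X \<longleftrightarrow>
     X \<in> M \<rightarrow>\<^sub>M path_space {0..T} \<and> (\<forall>t\<in>{0..T}. (\<lambda>\<omega>. X \<omega> t) \<in> F t \<rightarrow>\<^sub>M borel)"

definition brownian_motion ::
  "'w measure \<Rightarrow> (real \<Rightarrow> 'w measure) \<Rightarrow> real \<Rightarrow> ('w \<Rightarrow> (real^'m) path) \<Rightarrow> bool" where
  "brownian_motion M F T W \<longleftrightarrow>
     continuous_adapted M F T W \<and> (AE \<omega> in M. W \<omega> 0 = 0) \<and>
     (\<forall>s t. 0 \<le> s \<and> s < t \<and> t \<le> T \<longrightarrow>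
        prob_space.indep_set M (sets (F s))
          (sets (vimage_algebra (space M) (\<lambda>\<omega>. W \<omega> t - W \<omega> s) borel)) \<and>
        prob_space.indep_vars M (\<lambda>_. borel) (\<lambda>k \<omega>. (W \<omega> t - W \<omega> s) $ k) UNIV \<and>
        (\<forall>k. distributed M lborel (\<lambda>\<omega>. (W \<omega> t - W \<omega> s) $ k)
               (\<lambda>z. ennreal (normal_density 0 (sqrt (t - s)) z))))"

definition null_in_prob :: "'w measure \<Rightarrow> (nat \<Rightarrow> 'w \<Rightarrow> ennreal) \<Rightarrow> bool" where
  "null_in_prob M Y \<longleftrightarrow>
     (\<forall>\<epsilon>>0. (\<lambda>j. measure M {\<omega>\<in>space M. ennreal \<epsilon> < Y j \<omega>}) \<longlonglongrightarrow> 0)"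

text \<open>
  The simple process \<open>\<Sum>k<n. \<xi>\<^sub>k 1\<^bsub>(\<tau>\<^sub>k, \<tau>\<^sub>k\<^sub>+\<^sub>1]\<^esub>\<close> with bounded \<open>F (\<tau>\<^sub>k)\<close>-measurable \<open>\<xi>\<^sub>k\<close>, and its
  elementary stochastic integral.
\<close>

definition simple_integrand :: "'w measure \<Rightarrow> (real \<Rightarrow> 'w measure) \<Rightarrow> real \<Rightarrow>
    nat \<Rightarrow> (nat \<Rightarrow> real) \<Rightarrow> (nat \<Rightarrow> 'w \<Rightarrow> real^'m^'d) \<Rightarrow> bool" where
  "simple_integrand M F T n \<tau> \<xi> \<longleftrightarrow>
     0 \<le> \<tau> 0 \<and> \<tau> n \<le> T \<and> (\<forall>k<n. \<tau> k \<le> \<tau> (Suc k)) \<and>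
     (\<forall>k<n. \<xi> k \<in> F (\<tau> k) \<rightarrow>\<^sub>M borel \<and> (\<exists>C. \<forall>\<omega>\<in>space M. norm (\<xi> k \<omega>) \<le> C))"

definition simple_value ::
  "nat \<Rightarrow> (nat \<Rightarrow> real) \<Rightarrow> (nat \<Rightarrow> 'w \<Rightarrow> real^'m^'d) \<Rightarrow> real \<Rightarrow> 'w \<Rightarrow> real^'m^'d" where
  "simple_value n \<tau> \<xi> s \<omega> = (\<Sum>k<n. indicator {\<tau> k<..\<tau> (Suc k)} s *\<^sub>R \<xi> k \<omega>)"

definition simple_integral ::
  "nat \<Rightarrow> (nat \<Rightarrow> real) \<Rightarrow> (nat \<Rightarrow> 'w \<Rightarrow> real^'m^'d) \<Rightarrow> ('w \<Rightarrow> (real^'m) path) \<Rightarrow>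
     real \<Rightarrow> 'w \<Rightarrow> real^'d" where
  "simple_integral n \<tau> \<xi> W t \<omega> =
     (\<Sum>k<n. \<xi> k \<omega> *v (W \<omega> (min (\<tau> (Suc k)) t) - W \<omega> (min (\<tau> k) t)))"

text \<open>
  \<open>J\<close> is a continuous version of \<open>t \<mapsto> \<integral>\<^sub>0\<^sup>t H\<^sub>s dW\<^sub>s\<close> on \<open>[0,T]\<close>, for a progressive \<open>H\<close> with
  \<open>\<integral>\<^sub>0\<^sup>T |H\<^sub>s|\<^sup>2 ds < \<infinity>\<close> almost surely: the limit, uniformly on \<open>[0,T]\<close> in probability, of the
  integrals of simple processes \<open>H\<^sup>j\<close> with \<open>\<integral>\<^sub>0\<^sup>T |H\<^sup>j\<^sub>s - H\<^sub>s|\<^sup>2 ds \<rightarrow> 0\<close> in probability.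
\<close>

definition has_ito_integral :: "'w measure \<Rightarrow> (real \<Rightarrow> 'w measure) \<Rightarrow> real \<Rightarrow>
    ('w \<Rightarrow> (real^'m) path) \<Rightarrow> (real \<Rightarrow> 'w \<Rightarrow> real^'m^'d) \<Rightarrow> ('w \<Rightarrow> (real^'d) path) \<Rightarrow> bool" where
  "has_ito_integral M F T W H J \<longleftrightarrow>
     (\<forall>t\<in>{0..T}. (\<lambda>(s, \<omega>). H s \<omega>) \<in> restrict_space borel {0..t} \<Otimes>\<^sub>M F t \<rightarrow>\<^sub>M borel) \<and>
     (AE \<omega> in M. (\<integral>\<^sup>+s\<in>{0..T}. ennreal ((norm (H s \<omega>))\<^sup>2) \<partial>lborel) < \<infinity>) \<and>
     J \<in> M \<rightarrow>\<^sub>M path_space {0..T} \<and>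
     (\<exists>n \<tau> \<xi>. (\<forall>j. simple_integrand M F T (n j) (\<tau> j) (\<xi> j)) \<and>
        null_in_prob M (\<lambda>j \<omega>. \<integral>\<^sup>+s\<in>{0..T}.
          ennreal ((norm (simple_value (n j) (\<tau> j) (\<xi> j) s \<omega> - H s \<omega>))\<^sup>2) \<partial>lborel) \<and>
        null_in_prob M (\<lambda>j \<omega>. SUP t\<in>{0..T}.
          ennreal (norm (simple_integral (n j) (\<tau> j) (\<xi> j) W t \<omega> - J \<omega> t))))"


section \<open>The McKean equation, the particle system and the limit system\<close>

text \<open>
  \<open>X\<^sub>t = X\<^sub>0 + \<integral>\<^sub>0\<^sup>t c(s,X) ds + \<integral>\<^sub>0\<^sup>t A(s,X) (b\<^sub>s ds + dW\<^sub>s)\<close> on \<open>[0,T]\<close>, for a given process \<open>b\<close>.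
\<close>

definition solves_sde :: "(real \<Rightarrow> (real^'d) path \<Rightarrow> real^'d) \<Rightarrow>
    (real \<Rightarrow> (real^'d) path \<Rightarrow> real^'m^'d) \<Rightarrow> (real \<Rightarrow> 'w \<Rightarrow> real^'m) \<Rightarrow> real \<Rightarrow>
    'w measure \<Rightarrow> (real \<Rightarrow> 'w measure) \<Rightarrow> ('w \<Rightarrow> (real^'m) path) \<Rightarrow> ('w \<Rightarrow> (real^'d) path) \<Rightarrow> bool" where
  "solves_sde c A b T M F W X \<longleftrightarrow>
     (AE \<omega> in M. set_integrable lborel {0..T} (\<lambda>s. c s (X \<omega>))) \<and>
     (AE \<omega> in M. set_integrable lborel {0..T} (\<lambda>s. A s (X \<omega>) *v b s \<omega>)) \<and>
     (\<exists>J. has_ito_integral M F T W (\<lambda>s \<omega>. A s (X \<omega>)) J \<and>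
       (AE \<omega> in M. \<forall>t\<in>{0..T}.
          X \<omega> t = X \<omega> 0 + (LINT s:{0..t}|lborel. c s (X \<omega>))
                  + (LINT s:{0..t}|lborel. A s (X \<omega>) *v b s \<omega>) + J \<omega> t))"

text \<open>
  Weak solutions.  Independence of \<open>W\<close> and \<open>X\<^sub>0\<close> holds because \<open>X\<^sub>0\<close> is \<open>F 0\<close>-measurable and \<open>W\<close> is a
  Brownian motion with respect to \<open>F\<close>.
\<close>

definition mckean_solution :: "(real \<Rightarrow> (real^'d) path \<Rightarrow> real^'d) \<Rightarrow>
    (real \<Rightarrow> (real^'d) path \<Rightarrow> real^'m^'d) \<Rightarrow>
    (real \<Rightarrow> (real^'d) path \<Rightarrow> (real^'d) path measure \<Rightarrow> real^'m) \<Rightarrow>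
    (real^'d) measure \<Rightarrow> real \<Rightarrow> 'w measure \<Rightarrow> (real \<Rightarrow> 'w measure) \<Rightarrow>
    ('w \<Rightarrow> (real^'m) path) \<Rightarrow> ('w \<Rightarrow> (real^'d) path) \<Rightarrow> bool" where
  "mckean_solution c A B \<mu>0 T M F W X \<longleftrightarrow>
     filtered_prob_space M F \<and> brownian_motion M F T W \<and> continuous_adapted M F T X \<and>
     distr M borel (\<lambda>\<omega>. X \<omega> 0) = \<mu>0 \<and>
     solves_sde c A (\<lambda>s \<omega>. B s (X \<omega>) (law_upto M X s)) T M F W X"

definition particle_solution :: "(real \<Rightarrow> (real^'d) path \<Rightarrow> real^'d) \<Rightarrow>
    (real \<Rightarrow> (real^'d) path \<Rightarrow> real^'m^'d) \<Rightarrow>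
    (real \<Rightarrow> (real^'d) path \<Rightarrow> (real^'d) path measure \<Rightarrow> real^'m) \<Rightarrow>
    (real^'d) measure \<Rightarrow> real \<Rightarrow> nat \<Rightarrow> 'w measure \<Rightarrow> (real \<Rightarrow> 'w measure) \<Rightarrow>
    (nat \<Rightarrow> 'w \<Rightarrow> (real^'m) path) \<Rightarrow> (nat \<Rightarrow> 'w \<Rightarrow> (real^'d) path) \<Rightarrow> bool" where
  "particle_solution c A B \<mu>0 T N M F W X \<longleftrightarrow>
     filtered_prob_space M F \<and>
     (\<forall>i\<in>{1..N}. brownian_motion M F T (W i) \<and> continuous_adapted M F T (X i) \<and>
        distr M borel (\<lambda>\<omega>. X i \<omega> 0) = \<mu>0) \<and>
     prob_space.indep_vars M (\<lambda>_. borel \<Otimes>\<^sub>M path_space {0..T}) (\<lambda>i \<omega>. (X i \<omega> 0, W i \<omega>)) {1..N} \<and>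
     (\<forall>i\<in>{1..N}.
        solves_sde c A (\<lambda>s \<omega>. B s (X i \<omega>) (empirical_upto N X \<omega> s)) T M F (W i) (X i))"

text \<open>
  A formula cannot quantify over the types of all sample spaces.  In the two assumptions below the
  sample spaces are arbitrary measures on the type of (families of) pairs of solution and Brownian
  path.  Nothing is lost: a weak solution on any probability space can be transported to this type by
  taking the joint law of solution and driving Brownian motion.
\<close>

type_synonym ('d, 'm) mckean_sample = "(real^'d) path \<times> (real^'m) path"
type_synonym ('d, 'm) particle_sample = "nat \<Rightarrow> (real^'d) path \<times> (real^'m) path"

definition assumption_A1 :: "(real \<Rightarrow> (real^'d) path \<Rightarrow> real^'d) \<Rightarrow>
    (real \<Rightarrow> (real^'d) path \<Rightarrow> real^'m^'d) \<Rightarrow>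
    (real \<Rightarrow> (real^'d) path \<Rightarrow> (real^'d) path measure \<Rightarrow> real^'m) \<Rightarrow> bool" where
  "assumption_A1 c A B \<longleftrightarrow>
     (\<forall>\<mu>0\<in>space (prob_algebra borel). \<forall>T>0.
       (\<exists>(M :: ('d, 'm) mckean_sample measure) F W X. mckean_solution c A B \<mu>0 T M F W X) \<and>
       (\<forall>(M :: ('d, 'm) mckean_sample measure) F W X (M' :: ('d, 'm) mckean_sample measure) F' W' X'.
          mckean_solution c A B \<mu>0 T M F W X \<and> mckean_solution c A B \<mu>0 T M' F' W' X' \<longrightarrow>
          distr M (path_space {0..T}) X = distr M' (path_space {0..T}) X') \<and>
       (\<forall>(M :: ('d, 'm) mckean_sample measure) F W X. mckean_solution c A B \<mu>0 T M F W X \<longrightarrow>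
          (AE \<omega> in M. (\<integral>\<^sup>+s\<in>{0..T}.
             ennreal ((norm (A s (X \<omega>) *v B s (X \<omega>) (law_upto M X s)))\<^sup>2) \<partial>lborel) < \<infinity>)))"

definition assumption_A2 :: "(real \<Rightarrow> (real^'d) path \<Rightarrow> real^'d) \<Rightarrow>
    (real \<Rightarrow> (real^'d) path \<Rightarrow> real^'m^'d) \<Rightarrow>
    (real \<Rightarrow> (real^'d) path \<Rightarrow> (real^'d) path measure \<Rightarrow> real^'m) \<Rightarrow> bool" where
  "assumption_A2 c A B \<longleftrightarrow>
     (\<forall>\<mu>0\<in>space (prob_algebra borel). \<forall>T>0. \<forall>N\<ge>1.
       (\<exists>(M :: ('d, 'm) particle_sample measure) F W X. particle_solution c A B \<mu>0 T N M F W X) \<and>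
       (\<forall>(M :: ('d, 'm) particle_sample measure) F W X (M' :: ('d, 'm) particle_sample measure) F' W' X'.
          particle_solution c A B \<mu>0 T N M F W X \<and> particle_solution c A B \<mu>0 T N M' F' W' X' \<longrightarrow>
          distr M (PiM {1..N} (\<lambda>_. path_space {0..T})) (\<lambda>\<omega>. \<lambda>i\<in>{1..N}. X i \<omega>) =
          distr M' (PiM {1..N} (\<lambda>_. path_space {0..T})) (\<lambda>\<omega>. \<lambda>i\<in>{1..N}. X' i \<omega>)) \<and>
       (\<forall>(M :: ('d, 'm) particle_sample measure) F W X. particle_solution c A B \<mu>0 T N M F W X \<longrightarrow>
          (AE \<omega> in M. \<forall>i\<in>{1..N}. (\<integral>\<^sup>+s\<in>{0..T}.
             ennreal ((norm (A s (X i \<omega>) *v B s (X i \<omega>) (empirical_upto N X \<omega> s)))\<^sup>2) \<partial>lborel) < \<infinity>)))"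

text \<open>
  \<open>N\<close> independent copies of the solution.  The last conjunct, that the copies share one law, follows from
  weak uniqueness; it is spelled out because it is part of being copies of the same solution.
\<close>

definition limit_system :: "(real \<Rightarrow> (real^'d) path \<Rightarrow> real^'d) \<Rightarrow>
    (real \<Rightarrow> (real^'d) path \<Rightarrow> real^'m^'d) \<Rightarrow>
    (real \<Rightarrow> (real^'d) path \<Rightarrow> (real^'d) path measure \<Rightarrow> real^'m) \<Rightarrow>
    (real^'d) measure \<Rightarrow> real \<Rightarrow> nat \<Rightarrow> 'w measure \<Rightarrow> (real \<Rightarrow> 'w measure) \<Rightarrow>
    (nat \<Rightarrow> 'w \<Rightarrow> (real^'m) path) \<Rightarrow> (nat \<Rightarrow> 'w \<Rightarrow> (real^'d) path) \<Rightarrow> bool" where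
  "limit_system c A B \<mu>0 T N M F W X \<longleftrightarrow>
     (\<forall>i\<in>{1..N}. mckean_solution c A B \<mu>0 T M F (W i) (X i)) \<and>
     prob_space.indep_vars M (\<lambda>_. borel \<Otimes>\<^sub>M path_space {0..T}) (\<lambda>i \<omega>. (X i \<omega> 0, W i \<omega>)) {1..N} \<and>
     prob_space.indep_vars M (\<lambda>_. path_space {0..T}) X {1..N} \<and>
     (\<forall>i\<in>{1..N}. \<forall>j\<in>{1..N}. distr M (path_space {0..T}) (X i) = distr M (path_space {0..T}) (X j))"

definition delta_B ::
  "(real \<Rightarrow> (real^'d) path \<Rightarrow> (real^'d) path measure \<Rightarrow> real^'m) \<Rightarrow> 'w measure \<Rightarrow> nat \<Rightarrow>
     (nat \<Rightarrow> 'w \<Rightarrow> (real^'d) path) \<Rightarrow> nat \<Rightarrow> real \<Rightarrow> 'w \<Rightarrow> real^'m" where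
  "delta_B B M N X i t \<omega> =
     B t (X i \<omega>) (empirical_upto N X \<omega> t) - B t (X i \<omega>) (law_upto M (X i) t)"

end

theory Submission
  imports Defs
begin

text \<open>
  Fix a time \<open>t\<close> and a component \<open>l\<close>, write \<open>F x Q\<close> for the \<open>l\<close>-th component of \<open>B t x Q\<close>, let \<open>K\<close> bound the
  flat derivatives \<open>D\<close> and \<open>D2\<close>, and let \<open>P\<close> be the common law of the independent paths
  \<open>X 1, \<dots>, X N\<close>.  The empirical measure arises from \<open>P\<close>, seen as \<open>N\<close> portions \<open>P / N\<close>, by replacing
  the portions one at a time by point masses of weight \<open>1 / N\<close> at the sample paths.  The portion of \<open>i\<close> comes
  first: the path \<open>X i\<close> is also the argument \<open>x\<close> of \<open>F\<close>, so it is frozen, and its replacement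
  changes \<open>F x\<close> by at most \<open>2 K / N\<close>.

  A later replacement turns a measure \<open>R\<close> into \<open>Q = R + (\<delta>\<^sub>z - P) / N\<close>, where \<open>z\<close> has law \<open>P\<close>
  and is independent of \<open>R\<close>.  By the first flat derivative it changes \<open>F x\<close> by at most \<open>2 K / N\<close>.  By the
  second one this change is \<open>(D R z - \<integral> D R dP) / N\<close> up to an error \<open>4 K / N\<^sup>2\<close>, and the leading term
  has mean zero.  So each step is a bounded increment with a drift of order \<open>1 / N\<^sup>2\<close> only, and
  Hoeffding's lemma bounds its exponential moment of parameter \<open>\<lambda>\<close> by
  \<open>exp (4 K \<bar>\<lambda>\<bar> / N\<^sup>2 + 2 \<lambda>\<^sup>2 K\<^sup>2 / N\<^sup>2)\<close> (lemma \<open>exp_moment_moved_mass\<close>).  Multiplying over the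
  steps, the error \<open>Z\<close> satisfies \<open>E exp (\<lambda> Z) \<le> exp (6 K \<bar>\<lambda>\<bar> / N + 2 \<lambda>\<^sup>2 K\<^sup>2 / N)\<close>
  (lemma \<open>exp_moment_empirical\<close>).

  Comparing \<open>Z\<^sup>2\<^sup>p\<close> with \<open>exp (\<lambda> Z) + exp (- \<lambda> Z)\<close> at \<open>\<lambda>\<^sup>2 = p N / K\<^sup>2\<close> gives
  \<open>E Z\<^sup>2\<^sup>p \<le> p! (8 e\<^sup>8 K\<^sup>2 / N)\<^sup>p\<close> (lemma \<open>even_moment_le\<close>); the growth \<open>p!\<close> rather than \<open>(2p)!\<close> is due to
  letting \<open>\<lambda>\<close> depend on \<open>p\<close>.  The power mean inequality in the time variable and in the component,
  together with Fubini's theorem, integrates this over a time window of length \<open>\<delta>\<close> at the price of a factor \<open>\<delta>\<^sup>p m\<^sup>p\<close>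
  (lemma \<open>time_integral_moment_le\<close>).  All constants depend on \<open>K\<close> and on the dimension \<open>m\<close> alone.
\<close>

section \<open>Power means of nonnegative integrals\<close>

text \<open>
  The rearrangement inequality for the similarly ordered pairs \<open>(a, b)\<close> and \<open>(a ^ n, b ^ n)\<close>.
\<close>

lemma mult_power_rearrangement:
  fixes a b :: ennreal
  shows "a * b ^ n + b * a ^ n \<le> a ^ Suc n + b ^ Suc n"
proof -
  have *: "x * y ^ n + y * x ^ n \<le> x ^ Suc n + y ^ Suc n" if "x \<le> y" for x y :: ennreal
  proof -
    from that[unfolded le_iff_add] obtain d where d: "y = x + d" ..
    have "d * x ^ n \<le> d * y ^ n"
      using that by (intro mult_left_mono power_mono) auto
    have "x * y ^ n + y * x ^ n = (x * y ^ n + x * x ^ n) + d * x ^ n"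
      by (subst (2) d) (simp only: distrib_right add.assoc)
    also have "\<dots> \<le> (x * y ^ n + x * x ^ n) + d * y ^ n"
      by (rule add_left_mono) fact
    also have "\<dots> = x * x ^ n + (x + d) * y ^ n"
      unfolding distrib_right by (simp only: ac_simps)
    also have "\<dots> = x ^ Suc n + y ^ Suc n"
      unfolding d[symmetric] power_Suc ..
    finally show ?thesis .
  qed
  show ?thesis
  proof (cases "a \<le> b")
    case True
    then show ?thesis by (rule *)
  next
    case False
    then have "b * a ^ n + a * b ^ n \<le> b ^ Suc n + a ^ Suc n"
      by (intro *) auto
    then show ?thesis by (simp only: add.commute)
  qed
qed

lemma nn_integral_product_sum:
  assumes [measurable]: "g \<in> borel_measurable M" "h \<in> borel_measurable M"
    "k \<in> borel_measurable M" "l \<in> borel_measurable M"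
  shows "(\<integral>\<^sup>+x. \<integral>\<^sup>+y. g x * h y + k x * l y \<partial>M \<partial>M) =
    (\<integral>\<^sup>+x. g x \<partial>M) * (\<integral>\<^sup>+x. h x \<partial>M) + (\<integral>\<^sup>+x. k x \<partial>M) * (\<integral>\<^sup>+x. l x \<partial>M)"
  by (simp add: nn_integral_add nn_integral_cmult nn_integral_multc)

text \<open>
  Chebyshev's integral inequality for the similarly ordered functions \<open>f\<close> and \<open>f ^ n\<close> gives the step
  from \<open>n\<close> to \<open>n + 1\<close>.  This route works for any measure and for infinite values of the integrals.
\<close>

lemma nn_integral_power_le:
  assumes [measurable]: "f \<in> borel_measurable M" and "1 \<le> p"
  shows "(\<integral>\<^sup>+x. f x \<partial>M) ^ p \<le> emeasure M (space M) ^ (p - 1) * (\<integral>\<^sup>+x. f x ^ p \<partial>M)"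
  using \<open>1 \<le> p\<close>
proof (induction p rule: nat_induct_at_least)
  case base
  then show ?case by simp
next
  case (Suc n)
  let ?I = "\<integral>\<^sup>+x. f x \<partial>M" and ?J = "\<integral>\<^sup>+x. f x ^ n \<partial>M" and ?K = "\<integral>\<^sup>+x. f x ^ Suc n \<partial>M"
  let ?m = "emeasure M (space M)"
  have "(\<integral>\<^sup>+x. \<integral>\<^sup>+y. f x * f y ^ n + f y * f x ^ n \<partial>M \<partial>M)
      \<le> (\<integral>\<^sup>+x. \<integral>\<^sup>+y. f x ^ Suc n + f y ^ Suc n \<partial>M \<partial>M)"
    by (intro nn_integral_mono mult_power_rearrangement)
  moreover have "(\<integral>\<^sup>+x. \<integral>\<^sup>+y. f x * f y ^ n + f y * f x ^ n \<partial>M \<partial>M) = ?I * ?J + ?I * ?J"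
    using nn_integral_product_sum[of f M "\<lambda>y. f y ^ n" "\<lambda>x. f x ^ n" f] by (simp add: mult.commute)
  moreover have "(\<integral>\<^sup>+x. \<integral>\<^sup>+y. f x ^ Suc n + f y ^ Suc n \<partial>M \<partial>M) = ?m * ?K + ?m * ?K"
    using nn_integral_product_sum[of "\<lambda>x. f x ^ Suc n" M "\<lambda>y. 1" "\<lambda>x. 1" "\<lambda>y. f y ^ Suc n"]
    by (simp add: mult.commute del: power_Suc)
  ultimately have "2 * (?I * ?J) \<le> 2 * (?m * ?K)"
    unfolding mult_2 by simp
  then have IJ: "?I * ?J \<le> ?m * ?K"
    by (subst (asm) ennreal_mult_le_mult_iff) auto
  have "?I ^ Suc n \<le> ?I * (?m ^ (n - 1) * ?J)"
    using Suc.IH by (simp add: mult_left_mono)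
  also have "\<dots> = ?m ^ (n - 1) * (?I * ?J)"
    by (simp add: ac_simps)
  also have "\<dots> \<le> ?m ^ (n - 1) * (?m * ?K)"
    by (intro mult_left_mono IJ) simp
  also have "\<dots> = ?m ^ (Suc n - 1) * ?K"
    using Suc.hyps by (cases n) (simp_all add: ac_simps)
  finally show ?case .
qed

section \<open>Moving mass of a probability measure towards a point\<close>

text \<open>
  Equality of the measures \<open>Q + e P\<close> and \<open>R + e U\<close>, extended from sets to integrands.  The sums of
  measures appear only through their values, which spares the construction of the sums themselves.
\<close>

lemma nn_integral_balance:
  fixes g :: "'a \<Rightarrow> ennreal"
  assumes sets: "sets Q = sets S" "sets P = sets S" "sets R = sets S" "sets U = sets S"
    and balance: "\<And>A. A \<in> sets S \<Longrightarrow>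
      emeasure Q A + e * emeasure P A = emeasure R A + e * emeasure U A"
    and g: "g \<in> borel_measurable S"
  shows "(\<integral>\<^sup>+x. g x \<partial>Q) + e * (\<integral>\<^sup>+x. g x \<partial>P) = (\<integral>\<^sup>+x. g x \<partial>R) + e * (\<integral>\<^sup>+x. g x \<partial>U)"
  using g
proof (induction rule: borel_measurable_induct)
  note [measurable_cong] = sets
  note [simp] = sets_eq_imp_space_eq[OF sets(1)] sets_eq_imp_space_eq[OF sets(2)]
    sets_eq_imp_space_eq[OF sets(3)] sets_eq_imp_space_eq[OF sets(4)]
  {
    case (cong f g)
    have "(\<integral>\<^sup>+x. f x \<partial>L) = (\<integral>\<^sup>+x. g x \<partial>L)" if "sets L = sets S" for L
      using cong(3) sets_eq_imp_space_eq[OF that] by (intro nn_integral_cong) simp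
    with cong(4) show ?case by (simp only: sets)
  next
    case (set A)
    then show ?case by (simp add: sets balance)
  next
    case (mult u c)
    from mult(2)[measurable] have "c * ((\<integral>\<^sup>+x. u x \<partial>Q) + e * (\<integral>\<^sup>+x. u x \<partial>P)) =
        c * ((\<integral>\<^sup>+x. u x \<partial>R) + e * (\<integral>\<^sup>+x. u x \<partial>U))"
      using mult by simp
    with mult(2)[measurable] show ?case
      by (simp add: nn_integral_cmult distrib_left ac_simps)
  next
    case (add u v)
    note [measurable] = add.hyps(1,3)
    show ?case
      using arg_cong2[where f="(+)", OF add.IH]
      by (simp add: nn_integral_add distrib_left ac_simps)
  next
    case (seq V)
    note [measurable] = seq(1)
    have *: "(\<integral>\<^sup>+x. (SUP i. V i x) \<partial>L) = (SUP i. \<integral>\<^sup>+x. V i x \<partial>L)" if [measurable_cong]: "sets L = sets S" for L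
      by (intro nn_integral_monotone_convergence_SUP \<open>incseq V\<close>) measurable
    have inc: "incseq (\<lambda>i. \<integral>\<^sup>+x. V i x \<partial>L)" for L
      using \<open>incseq V\<close> by (auto simp: incseq_def le_fun_def intro!: nn_integral_mono)
    have inc': "incseq (\<lambda>i. e * (\<integral>\<^sup>+x. V i x \<partial>L))" for L
      using inc[of L] by (auto simp: incseq_def intro!: mult_left_mono)
    have "(\<integral>\<^sup>+x. (SUP i. V i x) \<partial>Q) + e * (\<integral>\<^sup>+x. (SUP i. V i x) \<partial>P)
        = (SUP i. (\<integral>\<^sup>+x. V i x \<partial>Q) + e * (\<integral>\<^sup>+x. V i x \<partial>P))"
      unfolding *[OF sets(1)] *[OF sets(2)] ennreal_SUP_add[OF inc inc'] SUP_mult_left_ennreal ..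
    also have "\<dots> = (SUP i. (\<integral>\<^sup>+x. V i x \<partial>R) + e * (\<integral>\<^sup>+x. V i x \<partial>U))"
      unfolding seq.IH ..
    also have "\<dots> = (\<integral>\<^sup>+x. (SUP i. V i x) \<partial>R) + e * (\<integral>\<^sup>+x. (SUP i. V i x) \<partial>U)"
      unfolding *[OF sets(3)] *[OF sets(4)] ennreal_SUP_add[OF inc inc'] SUP_mult_left_ennreal ..
    finally show ?case
      by (simp add: image_comp)
  }
qed

text \<open>
  The relation \<open>Q = R + \<epsilon> (\<delta>\<^sub>z - P)\<close>.  All terms have been brought to the side where they are
  nonnegative, so that the equation can be read as one between measures.
\<close>

definition moved_mass :: "'a measure \<Rightarrow> 'a measure \<Rightarrow> real \<Rightarrow> 'a \<Rightarrow> 'a measure \<Rightarrow> 'a measure \<Rightarrow> bool" where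
  "moved_mass S P \<epsilon> z R Q \<longleftrightarrow>
     (\<forall>A\<in>sets S. measure Q A + \<epsilon> * measure P A = measure R A + \<epsilon> * indicator A z)"

lemma integral_moved_mass:
  fixes g :: "'a \<Rightarrow> real"
  assumes PRQ: "P \<in> space (prob_algebra S)" "R \<in> space (prob_algebra S)" "Q \<in> space (prob_algebra S)"
    and z: "z \<in> space S" and \<epsilon>: "0 \<le> \<epsilon>" and mm: "moved_mass S P \<epsilon> z R Q"
    and g[measurable]: "g \<in> borel_measurable S" and bnd: "\<And>w. w \<in> space S \<Longrightarrow> \<bar>g w\<bar> \<le> K"
  shows "(\<integral>w. g w \<partial>Q) - (\<integral>w. g w \<partial>R) = \<epsilon> * (g z - (\<integral>w. g w \<partial>P))"
proof -
  have U: "return S z \<in> space (prob_algebra S)"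
    using z by (auto simp: space_prob_algebra prob_space_return)
  have nn: "(\<integral>\<^sup>+w. ennreal (g w + K) \<partial>L) = ennreal ((\<integral>w. g w \<partial>L) + K)"
    and nonneg: "0 \<le> (\<integral>w. g w \<partial>L) + K"
    if L: "L \<in> space (prob_algebra S)" for L
  proof -
    interpret L: prob_space L using L by (simp add: space_prob_algebra)
    from L have [measurable_cong]: "sets L = sets S" by (simp add: space_prob_algebra)
    have bL: "\<bar>g w\<bar> \<le> K" if "w \<in> space L" for w
      using bnd that sets_eq_imp_space_eq[OF \<open>sets L = sets S\<close>] by auto
    have i: "integrable L g"
      by (rule L.integrable_const_bound[where B=K]) (use bL in auto)
    have eq: "(\<integral>w. g w + K \<partial>L) = (\<integral>w. g w \<partial>L) + K"
      using i by (simp add: L.prob_space)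
    \<comment> \<open>Adding \<open>K\<close> makes the integrand nonnegative; the constants cancel at the end since all measures
      involved have total mass one.\<close>
    have ae: "AE w in L. 0 \<le> g w + K"
      using bL by (intro AE_I2) (auto simp: abs_le_iff dest!: bL)
    show "(\<integral>\<^sup>+w. ennreal (g w + K) \<partial>L) = ennreal ((\<integral>w. g w \<partial>L) + K)"
      using i ae by (subst nn_integral_eq_integral) (simp_all add: eq L.prob_space)
    show "0 \<le> (\<integral>w. g w \<partial>L) + K"
      unfolding eq[symmetric] using ae by (rule integral_nonneg_AE)
  qed
  have em: "emeasure L A = ennreal (measure L A)" if "L \<in> space (prob_algebra S)" for L A
    using that by (auto simp: space_prob_algebra prob_space_def intro: finite_measure.emeasure_eq_measure)
  have "(\<integral>\<^sup>+w. ennreal (g w + K) \<partial>Q) + ennreal \<epsilon> * (\<integral>\<^sup>+w. ennreal (g w + K) \<partial>P) =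
      (\<integral>\<^sup>+w. ennreal (g w + K) \<partial>R) + ennreal \<epsilon> * (\<integral>\<^sup>+w. ennreal (g w + K) \<partial>return S z)"
  proof (rule nn_integral_balance)
    fix A assume A: "A \<in> sets S"
    have "measure (return S z) A = indicator A z"
      using A by (simp add: measure_return)
    then show "emeasure Q A + ennreal \<epsilon> * emeasure P A = emeasure R A + ennreal \<epsilon> * emeasure (return S z) A"
      using mm A \<epsilon> PRQ U
      by (simp add: em moved_mass_def ennreal_mult[symmetric] ennreal_plus[symmetric] del: ennreal_plus)
  qed (use PRQ in \<open>auto simp: space_prob_algebra\<close>)
  then have "((\<integral>w. g w \<partial>Q) + K) + \<epsilon> * ((\<integral>w. g w \<partial>P) + K) =
      ((\<integral>w. g w \<partial>R) + K) + \<epsilon> * ((\<integral>w. g w \<partial>return S z) + K)"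
    using PRQ U nonneg[OF PRQ(1)] nonneg[OF PRQ(2)] nonneg[OF PRQ(3)] nonneg[OF U] \<epsilon>
    by (simp add: nn ennreal_mult[symmetric] ennreal_plus[symmetric] del: ennreal_plus)
  moreover have "(\<integral>w. g w \<partial>return S z) = g z"
    using z by (simp add: integral_return)
  ultimately show ?thesis
    by (simp add: algebra_simps)
qed

lemma mix_measure_in_prob_algebra:
  assumes "R \<in> space (prob_algebra S)" "Q \<in> space (prob_algebra S)" "\<alpha> \<in> {0..1}"
  shows "mix_measure \<alpha> R Q \<in> space (prob_algebra S)"
proof -
  from assms have sets: "sets R = sets S" "sets Q = sets R" and "prob_space R" "prob_space Q"
    by (auto simp: space_prob_algebra)
  then have "emeasure R (space R) = 1" "emeasure Q (space R) = 1"
    using prob_space.emeasure_space_1 sets_eq_imp_space_eq by metis+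
  then have "emeasure (mix_measure \<alpha> R Q) (space R) = 1"
    using assms(3) sets(2)
    by (simp add: emeasure_mix_measure ennreal_plus[symmetric] del: ennreal_plus)
  moreover have "space (mix_measure \<alpha> R Q) = space R" "sets (mix_measure \<alpha> R Q) = sets R"
    by (simp_all add: mix_measure_def)
  ultimately show ?thesis
    using sets by (auto simp: space_prob_algebra intro!: prob_spaceI)
qed

text \<open>
  The segment from \<open>R\<close> to \<open>Q\<close> consists of partial moves of the same kind; hence bounds for a single move
  also control the integrands in the definition of the flat derivatives.
\<close>

lemma moved_mass_mix:
  assumes "R \<in> space (prob_algebra S)" "Q \<in> space (prob_algebra S)" "\<alpha> \<in> {0..1}"
    and mm: "moved_mass S P \<epsilon> z R Q"
  shows "moved_mass S P (\<alpha> * \<epsilon>) z R (mix_measure \<alpha> R Q)"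
  unfolding moved_mass_def
proof
  fix A assume A: "A \<in> sets S"
  interpret R: prob_space R using assms by (simp add: space_prob_algebra)
  interpret Q: prob_space Q using assms by (simp add: space_prob_algebra)
  have sets: "sets Q = sets R" "A \<in> sets R"
    using assms A by (auto simp: space_prob_algebra)
  have m: "measure (mix_measure \<alpha> R Q) A = (1 - \<alpha>) * measure R A + \<alpha> * measure Q A"
    unfolding measure_def[of "mix_measure \<alpha> R Q"] emeasure_mix_measure[OF sets]
    using assms(3) by (simp add: R.emeasure_eq_measure Q.emeasure_eq_measure ennreal_mult[symmetric]
      ennreal_plus[symmetric] enn2real_ennreal del: ennreal_plus)
  have "measure Q A + \<epsilon> * measure P A = measure R A + \<epsilon> * indicator A z"
    using mm A by (auto simp: moved_mass_def)
  then have "\<alpha> * (measure Q A + \<epsilon> * measure P A) = \<alpha> * (measure R A + \<epsilon> * indicator A z)"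
    by simp
  then show "measure (mix_measure \<alpha> R Q) A + \<alpha> * \<epsilon> * measure P A =
      measure R A + \<alpha> * \<epsilon> * indicator A z"
    unfolding m by (simp add: algebra_simps)
qed

lemma measurable_mix_measure:
  assumes RQ: "R \<in> space (prob_algebra S)" "Q \<in> space (prob_algebra S)"
  shows "(\<lambda>\<alpha>. mix_measure \<alpha> R Q) \<in> restrict_space borel {0..1} \<rightarrow>\<^sub>M prob_algebra S"
proof (rule measurable_prob_algebra_generated[OF sets.sigma_sets_eq[symmetric] sets.Int_stable sets.space_closed])
  fix \<alpha> :: real assume "\<alpha> \<in> space (restrict_space borel {0..1})"
  then have "mix_measure \<alpha> R Q \<in> space (prob_algebra S)"
    using mix_measure_in_prob_algebra[OF RQ] by (simp add: space_restrict_space)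
  then show "prob_space (mix_measure \<alpha> R Q)" "sets (mix_measure \<alpha> R Q) = sets S"
    by (auto simp: space_prob_algebra)
next
  fix A assume "A \<in> sets S"
  then show "(\<lambda>\<alpha>. emeasure (mix_measure \<alpha> R Q) A) \<in> borel_measurable (restrict_space borel {0..1})"
    using RQ by (subst emeasure_mix_measure) (auto simp: space_prob_algebra intro!: measurable_restrict_space1)
qed

section \<open>Functionals with a bounded second order flat derivative\<close>

lemma abs_unit_interval_integral_le:
  fixes h :: "real \<Rightarrow> real"
  assumes "\<And>\<alpha>. \<alpha> \<in> {0..1} \<Longrightarrow> \<bar>h \<alpha>\<bar> \<le> C"
  shows "\<bar>LINT \<alpha>:{0..1}|lborel. h \<alpha>\<bar> \<le> C"
proof -
  have C: "0 \<le> C"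
    using assms[of 0] by simp
  have "\<bar>LINT \<alpha>:{0..1}|lborel. h \<alpha>\<bar> \<le> (\<integral>\<alpha>. \<bar>indicator {0..1} \<alpha> *\<^sub>R h \<alpha>\<bar> \<partial>lborel)"
    unfolding set_lebesgue_integral_def by (rule integral_abs_bound)
  also have "\<dots> \<le> (\<integral>\<alpha>. indicator {0..1::real} \<alpha> * C \<partial>lborel)"
  proof (rule integral_mono')
    show "integrable lborel (\<lambda>\<alpha>. indicator {0..1::real} \<alpha> * C)"
      by (intro integrable_mult_left integrable_real_indicator) auto
  qed (use assms C in \<open>auto simp: indicator_def\<close>)
  also have "\<dots> = C"
    by simp
  finally show ?thesis .
qed

text \<open>
  Measurability cannot be dropped: the integral of a function that is not integrable is \<open>0\<close> by convention,
  which need not be close to \<open>c\<close>.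
\<close>

lemma unit_interval_integral_close:
  fixes h :: "real \<Rightarrow> real"
  assumes h: "h \<in> borel_measurable (restrict_space borel {0..1})"
    and close: "\<And>\<alpha>. \<alpha> \<in> {0..1} \<Longrightarrow> \<bar>h \<alpha> - c\<bar> \<le> C"
  shows "\<bar>(LINT \<alpha>:{0..1}|lborel. h \<alpha>) - c\<bar> \<le> C"
proof -
  have c: "set_integrable lborel {0..1::real} (\<lambda>_. c)"
    unfolding set_integrable_def by (intro integrable_scaleR_left integrable_real_indicator) auto
  have "set_borel_measurable lborel {0..1} h"
    using h by (simp add: set_borel_measurable_def borel_measurable_restrict_space_iff)
  moreover have "\<bar>h \<alpha>\<bar> \<le> \<bar>c\<bar> + C" if "\<alpha> \<in> {0..1}" for \<alpha>
    using close[OF that] by linarith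
  moreover have "set_integrable lborel {0..1::real} (\<lambda>_. \<bar>c\<bar> + C)"
    unfolding set_integrable_def by (intro integrable_scaleR_left integrable_real_indicator) auto
  ultimately have "set_integrable lborel {0..1} h"
    by (intro set_integrable_bound[of lborel "{0..1}" "\<lambda>_. \<bar>c\<bar> + C" h])
      (auto intro!: AE_I2 intro: order_trans[OF _ abs_ge_self])
  then have "(LINT \<alpha>:{0..1}|lborel. h \<alpha>) - (LINT \<alpha>:{0..1::real}|lborel. c) = (LINT \<alpha>:{0..1}|lborel. h \<alpha> - c)"
    using c by (rule set_integral_diff(2)[symmetric])
  moreover have "(LINT \<alpha>:{0..1::real}|lborel. c) = c"
    by (simp add: set_lebesgue_integral_def)
  ultimately show ?thesis
    using abs_unit_interval_integral_le[of "\<lambda>\<alpha>. h \<alpha> - c" C] close by simp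
qed

lemma abs_integral_le:
  assumes "P \<in> space (prob_algebra S)" "\<And>w. w \<in> space S \<Longrightarrow> \<bar>g w\<bar> \<le> C" "0 \<le> C"
  shows "\<bar>\<integral>w. g w \<partial>P\<bar> \<le> (C::real)"
proof -
  interpret P: prob_space P using assms by (simp add: space_prob_algebra)
  have "\<bar>\<integral>w. g w \<partial>P\<bar> \<le> (\<integral>w. \<bar>g w\<bar> \<partial>P)"
    by (rule integral_abs_bound)
  also have "\<dots> \<le> (\<integral>w. C \<partial>P)"
    using assms sets_eq_imp_space_eq[of P S]
    by (intro integral_mono') (auto simp: space_prob_algebra)
  finally show ?thesis
    by (simp add: P.prob_space)
qed

lemma abs_centred_le:
  assumes "P \<in> space (prob_algebra S)" "z \<in> space S" "\<And>w. w \<in> space S \<Longrightarrow> \<bar>g w\<bar> \<le> C"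
  shows "\<bar>g z - (\<integral>w. g w \<partial>P)\<bar> \<le> 2 * (C::real)"
  using abs_integral_le[of P S g C] assms(1) assms(3)[OF assms(2)] assms(3) by force

text \<open>
  The hypothesis on \<open>B\<close> at a fixed time and path argument and for one component, as a property of a
  functional on the probability measures over an arbitrary space.
\<close>

locale second_flat_derivative =
  fixes S :: "'a measure" and f :: "'a measure \<Rightarrow> real"
    and D :: "'a measure \<Rightarrow> 'a \<Rightarrow> real" and D2 :: "'a measure \<Rightarrow> 'a \<Rightarrow> 'a \<Rightarrow> real" and K :: real
  assumes measurable_f [measurable]: "f \<in> borel_measurable (prob_algebra S)"
    and measurable_D: "(\<lambda>(P, w). D P w) \<in> borel_measurable (prob_algebra S \<Otimes>\<^sub>M S)"
    and measurable_D2: "\<And>P w. P \<in> space (prob_algebra S) \<Longrightarrow> w \<in> space S \<Longrightarrow> D2 P w \<in> borel_measurable S"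
    and D_bound: "\<And>P w. P \<in> space (prob_algebra S) \<Longrightarrow> w \<in> space S \<Longrightarrow> \<bar>D P w\<bar> \<le> K"
    and D2_bound: "\<And>P w w'. P \<in> space (prob_algebra S) \<Longrightarrow> w \<in> space S \<Longrightarrow> w' \<in> space S \<Longrightarrow> \<bar>D2 P w w'\<bar> \<le> K"
    and f_diff: "\<And>P Q. P \<in> space (prob_algebra S) \<Longrightarrow> Q \<in> space (prob_algebra S) \<Longrightarrow>
      f Q - f P = (LINT \<alpha>:{0..1}|lborel.
        (\<integral>w. D (mix_measure \<alpha> P Q) w \<partial>Q) - (\<integral>w. D (mix_measure \<alpha> P Q) w \<partial>P))"
    and D_diff: "\<And>P Q w. P \<in> space (prob_algebra S) \<Longrightarrow> Q \<in> space (prob_algebra S) \<Longrightarrow> w \<in> space S \<Longrightarrow>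
      D Q w - D P w = (LINT \<alpha>:{0..1}|lborel.
        (\<integral>w'. D2 (mix_measure \<alpha> P Q) w w' \<partial>Q) - (\<integral>w'. D2 (mix_measure \<alpha> P Q) w w' \<partial>P))"
begin

lemma measurable_D_at: "P \<in> space (prob_algebra S) \<Longrightarrow> D P \<in> borel_measurable S"
  using measurable_compose[OF measurable_Pair1' measurable_D] by simp

context
  fixes P R Q z \<epsilon>
  assumes P: "P \<in> space (prob_algebra S)" and R: "R \<in> space (prob_algebra S)"
    and Q: "Q \<in> space (prob_algebra S)" and z: "z \<in> space S" and \<epsilon>: "0 \<le> \<epsilon>"
    and mm: "moved_mass S P \<epsilon> z R Q"
begin

text \<open>
  The integrals against \<open>Q - R\<close> reduce to \<open>\<epsilon>\<close> times a difference of values and means of \<open>D2\<close>,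
  which is at most \<open>2 K\<close>.
\<close>

lemma D_moved_mass:
  assumes w: "w \<in> space S"
  shows "\<bar>D Q w - D R w\<bar> \<le> 2 * K * \<epsilon>"
  unfolding D_diff[OF R Q w]
proof (rule abs_unit_interval_integral_le)
  fix \<alpha> :: real assume "\<alpha> \<in> {0..1}"
  then have mix: "mix_measure \<alpha> R Q \<in> space (prob_algebra S)"
    by (rule mix_measure_in_prob_algebra[OF R Q])
  have "(\<integral>w'. D2 (mix_measure \<alpha> R Q) w w' \<partial>Q) - (\<integral>w'. D2 (mix_measure \<alpha> R Q) w w' \<partial>R) =
      \<epsilon> * (D2 (mix_measure \<alpha> R Q) w z - (\<integral>w'. D2 (mix_measure \<alpha> R Q) w w' \<partial>P))"
    using measurable_D2[OF mix w] D2_bound[OF mix w] by (rule integral_moved_mass[OF P R Q z \<epsilon> mm])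
  moreover have "\<bar>D2 (mix_measure \<alpha> R Q) w z - (\<integral>w'. D2 (mix_measure \<alpha> R Q) w w' \<partial>P)\<bar> \<le> 2 * K"
    using D2_bound[OF mix w] by (rule abs_centred_le[OF P z])
  ultimately show "\<bar>(\<integral>w'. D2 (mix_measure \<alpha> R Q) w w' \<partial>Q) - (\<integral>w'. D2 (mix_measure \<alpha> R Q) w w' \<partial>R)\<bar>
      \<le> 2 * K * \<epsilon>"
    using \<epsilon> by (simp add: abs_mult mult_left_mono mult.commute[of _ \<epsilon>])
qed

lemma integral_D_moved_mass:
  assumes "T \<in> space (prob_algebra S)"
  shows "(\<integral>w. D T w \<partial>Q) - (\<integral>w. D T w \<partial>R) = \<epsilon> * (D T z - (\<integral>w. D T w \<partial>P))"
  using measurable_D_at[OF assms] D_bound[OF assms] by (rule integral_moved_mass[OF P R Q z \<epsilon> mm])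

lemma f_moved_mass: "\<bar>f Q - f R\<bar> \<le> 2 * K * \<epsilon>"
  unfolding f_diff[OF R Q]
proof (rule abs_unit_interval_integral_le)
  fix \<alpha> :: real assume "\<alpha> \<in> {0..1}"
  then have mix: "mix_measure \<alpha> R Q \<in> space (prob_algebra S)"
    by (rule mix_measure_in_prob_algebra[OF R Q])
  have "\<bar>D (mix_measure \<alpha> R Q) z - (\<integral>w. D (mix_measure \<alpha> R Q) w \<partial>P)\<bar> \<le> 2 * K"
    using D_bound[OF mix] by (rule abs_centred_le[OF P z])
  then show "\<bar>(\<integral>w. D (mix_measure \<alpha> R Q) w \<partial>Q) - (\<integral>w. D (mix_measure \<alpha> R Q) w \<partial>R)\<bar> \<le> 2 * K * \<epsilon>"
    unfolding integral_D_moved_mass[OF mix]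
    using \<epsilon> by (simp add: abs_mult mult_left_mono mult.commute[of _ \<epsilon>])
qed

end

text \<open>
  The linearisation of \<open>f\<close> at \<open>R\<close>.  Replacing \<open>D (mix_measure \<alpha> R Q)\<close> by \<open>D R\<close> costs \<open>2 K \<epsilon>\<close> per value, by
  \<open>D_moved_mass\<close>, hence \<open>4 K \<epsilon>\<close> for a value minus a mean, and a further factor \<open>\<epsilon>\<close> comes from \<open>Q - R\<close>.
\<close>

lemma f_moved_mass_linear:
  assumes P: "P \<in> space (prob_algebra S)" and R: "R \<in> space (prob_algebra S)"
    and Q: "Q \<in> space (prob_algebra S)" and z: "z \<in> space S" and \<epsilon>: "0 \<le> \<epsilon>"
    and mm: "moved_mass S P \<epsilon> z R Q"
  shows "\<bar>f Q - f R - \<epsilon> * (D R z - (\<integral>w. D R w \<partial>P))\<bar> \<le> 4 * K * \<epsilon>\<^sup>2"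
proof -
  interpret P: prob_space P using P by (simp add: space_prob_algebra)
  have [measurable_cong]: "sets P = sets S" using P by (simp add: space_prob_algebra)
  have K: "0 \<le> K"
    using D_bound[OF P z] by linarith
  let ?h = "\<lambda>\<alpha>. \<epsilon> * (D (mix_measure \<alpha> R Q) z - (\<integral>w. D (mix_measure \<alpha> R Q) w \<partial>P))"
  have f: "f Q - f R = (LINT \<alpha>:{0..1}|lborel. ?h \<alpha>)"
    unfolding f_diff[OF R Q]
    by (rule set_lebesgue_integral_cong)
      (auto simp: integral_D_moved_mass[OF P R Q z \<epsilon> mm] mix_measure_in_prob_algebra[OF R Q])
  have "\<bar>(LINT \<alpha>:{0..1}|lborel. ?h \<alpha>) - \<epsilon> * (D R z - (\<integral>w. D R w \<partial>P))\<bar> \<le> 4 * K * \<epsilon>\<^sup>2"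
  proof (rule unit_interval_integral_close)
    have 1: "(\<lambda>\<alpha>. D (mix_measure \<alpha> R Q) z) \<in> borel_measurable (restrict_space borel {0..1})"
      using measurable_compose[OF measurable_Pair[OF measurable_mix_measure[OF R Q] measurable_const[OF z]] measurable_D]
      by simp
    have "(\<lambda>(\<alpha>, w). D (mix_measure \<alpha> R Q) w) \<in> borel_measurable (restrict_space borel {0..1} \<Otimes>\<^sub>M P)"
      using measurable_compose[OF measurable_Pair[OF measurable_compose[OF measurable_fst measurable_mix_measure[OF R Q]] measurable_snd] measurable_D]
      by (simp add: split_beta' cong: measurable_cong_sets)
    then have 2: "(\<lambda>\<alpha>. \<integral>w. D (mix_measure \<alpha> R Q) w \<partial>P) \<in> borel_measurable (restrict_space borel {0..1})"
      by (rule P.borel_measurable_lebesgue_integral)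
    show "?h \<in> borel_measurable (restrict_space borel {0..1})"
      using 1 2 by simp
  next
    fix \<alpha> :: real assume \<alpha>: "\<alpha> \<in> {0..1}"
    let ?M = "mix_measure \<alpha> R Q"
    have mix: "?M \<in> space (prob_algebra S)"
      using \<alpha> by (rule mix_measure_in_prob_algebra[OF R Q])
    have close: "\<bar>D ?M w - D R w\<bar> \<le> 2 * K * \<epsilon>" if w: "w \<in> space S" for w
    proof -
      have "\<bar>D ?M w - D R w\<bar> \<le> 2 * K * (\<alpha> * \<epsilon>)"
        by (rule D_moved_mass[OF P R mix z _ moved_mass_mix[OF R Q \<alpha> mm] w]) (use \<alpha> \<epsilon> in auto)
      also have "\<dots> \<le> 2 * K * \<epsilon>"
        using \<alpha> \<epsilon> K by (intro mult_left_mono) (auto intro: mult_left_le_one_le)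
      finally show ?thesis .
    qed
    have i: "integrable P (D T)" if T: "T \<in> space (prob_algebra S)" for T
      using measurable_D_at[OF T] D_bound[OF T] sets_eq_imp_space_eq[OF \<open>sets P = sets S\<close>]
      by (intro P.integrable_const_bound[where B=K]) auto
    have "(D ?M z - (\<integral>w. D ?M w \<partial>P)) - (D R z - (\<integral>w. D R w \<partial>P)) =
        (D ?M z - D R z) - (\<integral>w. D ?M w - D R w \<partial>P)"
      using i[OF mix] i[OF R] by simp
    also have "\<bar>\<dots>\<bar> \<le> 2 * (2 * K * \<epsilon>)"
      using close by (rule abs_centred_le[OF P z])
    finally have "\<epsilon> * \<bar>(D ?M z - (\<integral>w. D ?M w \<partial>P)) - (D R z - (\<integral>w. D R w \<partial>P))\<bar> \<le> \<epsilon> * (2 * (2 * K * \<epsilon>))"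
      using \<epsilon> by (rule mult_left_mono)
    then show "\<bar>?h \<alpha> - \<epsilon> * (D R z - (\<integral>w. D R w \<partial>P))\<bar> \<le> 4 * K * \<epsilon>\<^sup>2"
      using \<epsilon> by (simp add: abs_mult right_diff_distrib[symmetric] power2_eq_square ac_simps)
  qed
  then show ?thesis
    unfolding f .
qed

text \<open>
  When \<open>z\<close> is drawn from \<open>P\<close>, the linear part of the increment \<open>f (Q z) - f R\<close> has mean zero, so the mean of
  the increment is of order \<open>\<epsilon>\<^sup>2\<close>, while the increment itself is bounded by \<open>2 K \<epsilon>\<close>.  Hoeffding's lemma
  combines the two.
\<close>

lemma exp_moment_moved_mass:
  assumes P: "P \<in> space (prob_algebra S)" and R: "R \<in> space (prob_algebra S)" and \<epsilon>: "0 \<le> \<epsilon>"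
    and Q: "Q \<in> S \<rightarrow>\<^sub>M prob_algebra S"
    and mm: "\<And>z. z \<in> space S \<Longrightarrow> moved_mass S P \<epsilon> z R (Q z)"
  shows "(\<integral>\<^sup>+z. ennreal (exp (l * (f (Q z) - f R))) \<partial>P)
    \<le> ennreal (exp (\<bar>l\<bar> * (4 * K * \<epsilon>\<^sup>2) + 2 * l\<^sup>2 * K\<^sup>2 * \<epsilon>\<^sup>2))"
proof -
  interpret P: prob_space P using P by (simp add: space_prob_algebra)
  have sP[measurable_cong]: "sets P = sets S" using P by (simp add: space_prob_algebra)
  note spP = sets_eq_imp_space_eq[OF sP]
  have fQ[measurable]: "(\<lambda>z. f (Q z)) \<in> borel_measurable P"
    using measurable_compose[OF Q measurable_f] by (simp cong: measurable_cong_sets)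
  have Qz: "Q z \<in> space (prob_algebra S)" if "z \<in> space S" for z
    using measurable_space[OF Q that] .
  have DR: "integrable P (D R)"
    using measurable_D_at[OF R] D_bound[OF R] spP
    by (intro P.integrable_const_bound[where B=K]) auto
  \<comment> \<open>Flipping the sign \<open>s\<close> of the increment reduces negative parameters to positive ones.\<close>
  have main: "(\<integral>\<^sup>+z. ennreal (exp (l * (s * (f (Q z) - f R)))) \<partial>P)
    \<le> ennreal (exp (l * (4 * K * \<epsilon>\<^sup>2) + 2 * l\<^sup>2 * K\<^sup>2 * \<epsilon>\<^sup>2))" if l: "0 < l" and s: "\<bar>s\<bar> = 1" for l s :: real
  proof -
    let ?V = "\<lambda>z. s * (f (Q z) - f R)"
    have V: "\<bar>?V z\<bar> \<le> 2 * K * \<epsilon>" if "z \<in> space S" for z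
      using f_moved_mass[OF P R Qz[OF that] that \<epsilon> mm[OF that]] s by (simp add: abs_mult)
    interpret V: interval_bounded_random_variable P ?V "- (2 * K * \<epsilon>)" "2 * K * \<epsilon>"
    proof
      show "?V \<in> borel_measurable P"
        using fQ by (intro borel_measurable_times borel_measurable_diff) auto
      show "AE z in P. ?V z \<in> {- (2 * K * \<epsilon>)..2 * K * \<epsilon>}"
        using V by (intro AE_I2) (simp add: spP abs_le_iff minus_le_iff)
    qed
    have intV: "integrable P ?V" by (rule V.integrable)
    let ?L = "\<lambda>z. s * (\<epsilon> * (D R z - (\<integral>w. D R w \<partial>P)))"
    have intL: "integrable P ?L"
      using DR by simp
    have "P.expectation ?L = 0"
      using DR by (simp add: P.prob_space)
    then have "P.expectation ?V = P.expectation (\<lambda>z. ?V z - ?L z)"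
      using intV intL by simp
    also have "\<dots> \<le> \<bar>\<integral>z. ?V z - ?L z \<partial>P\<bar>"
      by simp
    also have "\<dots> \<le> 4 * K * \<epsilon>\<^sup>2"
    proof (rule abs_integral_le[OF P])
      fix z assume zS: "z \<in> space S"
      have "?V z - ?L z = s * (f (Q z) - f R - \<epsilon> * (D R z - (\<integral>w. D R w \<partial>P)))"
        by (simp add: algebra_simps)
      then show "\<bar>?V z - ?L z\<bar> \<le> 4 * K * \<epsilon>\<^sup>2"
        using f_moved_mass_linear[OF P R Qz[OF zS] zS \<epsilon> mm[OF zS]] s by (simp only: abs_mult mult_1)
    next
      obtain z where "z \<in> space S" using P.not_empty spP by auto
      with D_bound[OF P this] show "0 \<le> 4 * K * \<epsilon>\<^sup>2" by (simp add: order_trans[OF abs_ge_zero])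
    qed
    finally have EV: "P.expectation ?V \<le> 4 * K * \<epsilon>\<^sup>2" .
    have "(\<integral>\<^sup>+z. ennreal (exp (l * ?V z)) \<partial>P) =
        ennreal (exp (l * P.expectation ?V)) * (\<integral>\<^sup>+z. ennreal (exp (l * (?V z - P.expectation ?V))) \<partial>P)"
      by (subst nn_integral_cmult[symmetric])
        (auto simp: ennreal_mult[symmetric] exp_add[symmetric] algebra_simps)
    also have "\<dots> \<le> ennreal (exp (l * (4 * K * \<epsilon>\<^sup>2))) * ennreal (exp (l\<^sup>2 * (2 * K * \<epsilon> - - (2 * K * \<epsilon>))\<^sup>2 / 8))"
      using l EV by (intro mult_mono V.Hoeffdings_lemma_nn_integral ennreal_leI) (auto intro: mult_left_mono)
    also have "\<dots> = ennreal (exp (l * (4 * K * \<epsilon>\<^sup>2) + 2 * l\<^sup>2 * K\<^sup>2 * \<epsilon>\<^sup>2))"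
      by (simp add: ennreal_mult[symmetric] exp_add[symmetric] power2_eq_square ac_simps)
    finally show ?thesis .
  qed
  consider "l = 0" | "0 < l" | "l < 0" by linarith
  then show ?thesis
  proof cases
    case 1
    then show ?thesis by (simp add: P.emeasure_space_1)
  next
    case 2
    then show ?thesis using main[of l 1] by simp
  next
    case 3
    then show ?thesis using main[of "- l" "-1"] by (simp add: algebra_simps)
  qed
qed

end

section \<open>Uniform mixtures and empirical measures\<close>

text \<open>
  The average of \<open>\<kappa> 1, \<dots>, \<kappa> N\<close>, written as the law of a draw from \<open>\<kappa> j\<close> for a uniformly chosen index \<open>j\<close>:
  in this form the probability kernel calculus applies to it.  It interpolates between \<open>P\<close> (all \<open>\<kappa> j\<close> equal to
  \<open>P\<close>) and an empirical measure (all \<open>\<kappa> j\<close> point masses).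
\<close>

definition uniform_mixture :: "nat \<Rightarrow> (nat \<Rightarrow> 'a measure) \<Rightarrow> 'a measure" where
  "uniform_mixture N \<kappa> = measure_pmf (pmf_of_set {1..N}) \<bind> \<kappa>"

lemma uniform_mixture_in_prob_algebra:
  assumes "\<And>j. \<kappa> j \<in> space (prob_algebra S)"
  shows "uniform_mixture N \<kappa> \<in> space (prob_algebra S)"
proof -
  have A: "measure_pmf (pmf_of_set {1..N}) \<in> space (prob_algebra (count_space UNIV))"
    by (simp add: space_prob_algebra prob_space_measure_pmf)
  have B: "\<kappa> \<in> count_space UNIV \<rightarrow>\<^sub>M prob_algebra S"
    using assms by simp
  show ?thesis
    using sets_bind'[OF A B] prob_space_bind'[OF A B]
    by (simp add: uniform_mixture_def space_prob_algebra)
qed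

lemma emeasure_uniform_mixture:
  assumes "1 \<le> N" "\<And>j. \<kappa> j \<in> space (prob_algebra S)" "A \<in> sets S"
  shows "emeasure (uniform_mixture N \<kappa>) A = (\<Sum>j=1..N. emeasure (\<kappa> j) A) / of_nat N"
proof -
  have "\<kappa> \<in> measure_pmf (pmf_of_set {1..N}) \<rightarrow>\<^sub>M subprob_algebra S"
    using assms(2) by (auto simp: space_subprob_algebra space_prob_algebra prob_space_imp_subprob_space)
  then show ?thesis
    unfolding uniform_mixture_def using assms(1,3)
    by (subst emeasure_bind[where N=S]) (auto simp: nn_integral_pmf_of_set ennreal_of_nat_eq_real_of_nat)
qed

lemma measure_uniform_mixture:
  assumes "1 \<le> N" "\<And>j. \<kappa> j \<in> space (prob_algebra S)" "A \<in> sets S"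
  shows "measure (uniform_mixture N \<kappa>) A = (\<Sum>j=1..N. measure (\<kappa> j) A) / N"
proof -
  have em: "emeasure (\<kappa> j) A = ennreal (measure (\<kappa> j) A)" for j
    using assms(2)[of j] by (auto simp: space_prob_algebra prob_space_def intro: finite_measure.emeasure_eq_measure)
  show ?thesis
    unfolding measure_def[of "uniform_mixture N \<kappa>"] emeasure_uniform_mixture[OF assms] em
    using assms(1) by (simp add: sum_ennreal sum_nonneg divide_ennreal ennreal_of_nat_eq_real_of_nat)
qed

lemma measurable_uniform_mixture:
  assumes N: "1 \<le> N" and \<kappa>: "\<And>j. (\<lambda>y. \<kappa> y j) \<in> L \<rightarrow>\<^sub>M prob_algebra S"
  shows "(\<lambda>y. uniform_mixture N (\<kappa> y)) \<in> L \<rightarrow>\<^sub>M prob_algebra S"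
proof (rule measurable_prob_algebra_generated[OF sets.sigma_sets_eq[symmetric] sets.Int_stable sets.space_closed])
  fix y assume "y \<in> space L"
  then have "\<kappa> y j \<in> space (prob_algebra S)" for j
    using measurable_space[OF \<kappa>] by auto
  then have "uniform_mixture N (\<kappa> y) \<in> space (prob_algebra S)"
    by (rule uniform_mixture_in_prob_algebra)
  then show "prob_space (uniform_mixture N (\<kappa> y))" "sets (uniform_mixture N (\<kappa> y)) = sets S"
    by (auto simp: space_prob_algebra)
next
  fix A assume A: "A \<in> sets S"
  have "(\<lambda>y. emeasure (\<kappa> y j) A) \<in> borel_measurable L" for j
    by (rule measurable_compose[OF measurable_prob_algebraD[OF \<kappa>] measurable_emeasure_subprob_algebra[OF A]])
  then have "(\<lambda>y. (\<Sum>j=1..N. emeasure (\<kappa> y j) A) / of_nat N) \<in> borel_measurable L"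
    by simp
  moreover have "emeasure (uniform_mixture N (\<kappa> y)) A = (\<Sum>j=1..N. emeasure (\<kappa> y j) A) / of_nat N"
    if "y \<in> space L" for y
    using measurable_space[OF \<kappa> that] by (intro emeasure_uniform_mixture[OF N _ A])
  ultimately show "(\<lambda>y. emeasure (uniform_mixture N (\<kappa> y)) A) \<in> borel_measurable L"
    by (simp cong: measurable_cong)
qed

lemma uniform_mixture_const:
  assumes "1 \<le> N" "P \<in> space (prob_algebra S)"
  shows "uniform_mixture N (\<lambda>_. P) = P"
proof (rule measure_eqI)
  show "sets (uniform_mixture N (\<lambda>_. P)) = sets P"
    using uniform_mixture_in_prob_algebra[of "\<lambda>_. P" S N] assms by (simp add: space_prob_algebra)
  fix A assume "A \<in> sets (uniform_mixture N (\<lambda>_. P))"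
  then have "A \<in> sets S"
    using uniform_mixture_in_prob_algebra[of "\<lambda>_. P" S N] assms by (simp add: space_prob_algebra)
  then show "emeasure (uniform_mixture N (\<lambda>_. P)) A = emeasure P A"
    using assms by (subst emeasure_uniform_mixture[where S=S])
      (simp_all add: mult_divide_eq_ennreal mult.commute[of "of_nat N"])
qed

lemma sets_empirical_measure [simp]: "sets (empirical_measure S N y) = sets S"
  and space_empirical_measure [simp]: "space (empirical_measure S N y) = space S"
  by (simp_all add: empirical_measure_def)

lemma empirical_measure_eq_uniform_mixture:
  assumes "1 \<le> N" "P \<in> space (prob_algebra S)" "\<And>j. j \<in> {1..N} \<Longrightarrow> y j \<in> space S"
  shows "empirical_measure S N y = uniform_mixture N (\<lambda>j. if j \<in> {1..N} then return S (y j) else P)"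
    (is "_ = uniform_mixture N ?\<kappa>")
proof (rule measure_eqI)
  have \<kappa>: "?\<kappa> j \<in> space (prob_algebra S)" for j
    using assms by (auto simp: space_prob_algebra prob_space_return)
  then have s: "sets (uniform_mixture N ?\<kappa>) = sets S"
    using uniform_mixture_in_prob_algebra[of ?\<kappa> S N] by (simp add: space_prob_algebra)
  show "sets (empirical_measure S N y) = sets (uniform_mixture N ?\<kappa>)"
    unfolding s by simp
  fix A assume "A \<in> sets (empirical_measure S N y)"
  then have "A \<in> sets S"
    by simp
  with \<kappa> assms(1) show "emeasure (empirical_measure S N y) A = emeasure (uniform_mixture N ?\<kappa>) A"
    by (simp add: emeasure_empirical_measure emeasure_uniform_mixture[where S=S] del: emeasure_return)
qed

lemma measurable_empirical_measure:
  assumes N: "1 \<le> N" and Y: "\<And>j. j \<in> {1..N} \<Longrightarrow> Y j \<in> L \<rightarrow>\<^sub>M S"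
  shows "(\<lambda>\<omega>. empirical_measure S N (\<lambda>j. Y j \<omega>)) \<in> L \<rightarrow>\<^sub>M prob_algebra S"
proof -
  \<comment> \<open>The value outside \<open>{1..N}\<close> is arbitrary, but must be a probability measure on \<open>S\<close>.\<close>
  let ?\<kappa> = "\<lambda>\<omega> j. if j \<in> {1..N} then return S (Y j \<omega>) else return S (Y 1 \<omega>)"
  have \<kappa>: "(\<lambda>\<omega>. ?\<kappa> \<omega> j) \<in> L \<rightarrow>\<^sub>M prob_algebra S" for j
    using N by (cases "j \<in> {1..N}") (auto intro!: measurable_compose[OF Y])
  have "empirical_measure S N (\<lambda>j. Y j \<omega>) = uniform_mixture N (?\<kappa> \<omega>)" if "\<omega> \<in> space L" for \<omega>
    using N measurable_space[OF Y that]
    by (intro empirical_measure_eq_uniform_mixture) (auto simp: space_prob_algebra prob_space_return)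
  then show ?thesis
    using measurable_uniform_mixture[OF N \<kappa>] by (simp cong: measurable_cong)
qed

lemma moved_mass_uniform_mixture:
  assumes N: "1 \<le> N" and i: "i \<in> {1..N}" and \<kappa>: "\<And>j. \<kappa> j \<in> space (prob_algebra S)"
    and z: "z \<in> space S"
  shows "moved_mass S (\<kappa> i) (1 / N) z (uniform_mixture N \<kappa>) (uniform_mixture N (\<kappa>(i := return S z)))"
  unfolding moved_mass_def
proof
  fix A assume A: "A \<in> sets S"
  have \<kappa>': "(\<kappa>(i := return S z)) j \<in> space (prob_algebra S)" for j
    using \<kappa> z by (auto simp: space_prob_algebra prob_space_return)
  have 1: "(\<Sum>j=1..N. measure (\<kappa> j) A) = measure (\<kappa> i) A + (\<Sum>j\<in>{1..N}-{i}. measure (\<kappa> j) A)"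
    using i by (simp add: sum.remove)
  have 2: "(\<Sum>j=1..N. measure ((\<kappa>(i := return S z)) j) A) =
      indicator A z + (\<Sum>j\<in>{1..N}-{i}. measure (\<kappa> j) A)"
    using i A by (subst sum.remove[of _ i]) (auto simp: measure_return intro!: sum.cong)
  show "measure (uniform_mixture N (\<kappa>(i := return S z))) A + 1 / N * measure (\<kappa> i) A =
      measure (uniform_mixture N \<kappa>) A + 1 / N * indicator A z"
    unfolding measure_uniform_mixture[OF N \<kappa> A] measure_uniform_mixture[OF N \<kappa>' A] 1 2
    by (simp add: add_divide_distrib)
qed

section \<open>Exponential moments of the error of the empirical measure\<close>

context second_flat_derivative
begin

text \<open>
  The portions of \<open>P\<close> with index in \<open>I\<close>, and the one with index \<open>i\<close>, have been replaced by point masses.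
  The induction adds one index at a time: given the other coordinates, integrating out the new one
  multiplies the exponential moment by the factor of \<open>exp_moment_moved_mass\<close> with \<open>\<epsilon> = 1 / N\<close>.
\<close>

lemma exp_moment_partial_empirical:
  assumes P: "P \<in> space (prob_algebra S)" and x: "x \<in> space S" and i: "i \<in> {1..N}"
  defines "\<kappa> \<equiv> \<lambda>I y j. if j = i then return S x else if j \<in> I then return S (y j) else P"
  assumes fin: "finite I" and "I \<subseteq> {1..N} - {i}"
  shows "(\<integral>\<^sup>+y. ennreal (exp (l * (f (uniform_mixture N (\<kappa> I y)) - f P))) \<partial>(\<Pi>\<^sub>M j\<in>I. P))
    \<le> ennreal (exp (\<bar>l\<bar> * (2 * K / N) +
          card I * (\<bar>l\<bar> * (4 * K / (real N)\<^sup>2) + 2 * l\<^sup>2 * K\<^sup>2 / (real N)\<^sup>2)))"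
  using fin \<open>I \<subseteq> {1..N} - {i}\<close>
proof (induction I rule: finite_induct)
  case empty
  have N: "1 \<le> N" using i by simp
  let ?Q = "uniform_mixture N (\<kappa> {} undefined)"
  have \<kappa>0: "\<kappa> {} y = (\<lambda>_. P)(i := return S x)" for y
    by (auto simp: \<kappa>_def)
  have Q: "?Q \<in> space (prob_algebra S)"
    unfolding \<kappa>0 using P x by (intro uniform_mixture_in_prob_algebra) (auto simp: space_prob_algebra prob_space_return)
  have "moved_mass S P (1 / N) x P ?Q"
    using moved_mass_uniform_mixture[OF N i, of "\<lambda>_. P" S x] P x
    unfolding \<kappa>0 by (simp add: uniform_mixture_const[OF N P])
  then have "\<bar>f ?Q - f P\<bar> \<le> 2 * K * (1 / N)"
    by (intro f_moved_mass[OF P P Q x]) auto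
  then have "\<bar>l\<bar> * \<bar>f ?Q - f P\<bar> \<le> \<bar>l\<bar> * (2 * K / N)"
    by (intro mult_left_mono) auto
  then have "l * (f ?Q - f P) \<le> \<bar>l\<bar> * (2 * K / N)"
    by (metis abs_mult abs_le_D1)
  then show ?case
    by (simp add: PiM_empty \<kappa>0 fun_upd_def)
next
  case (insert j I)
  have N: "1 \<le> N" using i by simp
  interpret P: prob_space P using P by (simp add: space_prob_algebra)
  interpret product_sigma_finite "\<lambda>_. P" by standard
  have sP[measurable_cong]: "sets P = sets S" using P by (simp add: space_prob_algebra)
  have P': "P \<in> space (prob_algebra S)" by fact
  let ?c = "\<bar>l\<bar> * (4 * K / (real N)\<^sup>2) + 2 * l\<^sup>2 * K\<^sup>2 / (real N)\<^sup>2"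
  let ?e = "\<lambda>J y. ennreal (exp (l * (f (uniform_mixture N (\<kappa> J y)) - f P)))"
  have \<kappa>_space: "\<kappa> J y j \<in> space (prob_algebra S)" if "\<And>k. k \<in> J \<Longrightarrow> y k \<in> space S" for J y j
    using that P x by (auto simp: \<kappa>_def space_prob_algebra prob_space_return)
  have um: "(\<lambda>y. uniform_mixture N (\<kappa> J y)) \<in> (\<Pi>\<^sub>M j\<in>J. P) \<rightarrow>\<^sub>M prob_algebra S" for J
  proof (rule measurable_uniform_mixture[OF N])
    fix k
    have "return S \<in> P \<rightarrow>\<^sub>M prob_algebra S"
      by (simp cong: measurable_cong_sets)
    moreover have "return S x \<in> space (prob_algebra S)"
      using x by (simp add: space_prob_algebra prob_space_return)
    ultimately show "(\<lambda>y. \<kappa> J y k) \<in> (\<Pi>\<^sub>M j\<in>J. P) \<rightarrow>\<^sub>M prob_algebra S"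
      using P' unfolding \<kappa>_def
      by (cases "k = i"; cases "k \<in> J") (auto intro: measurable_compose[OF measurable_component_singleton])
  qed
  have meas: "?e J \<in> borel_measurable (\<Pi>\<^sub>M j\<in>J. P)" for J
    using measurable_compose[OF um measurable_f] by simp
  have inner: "(\<integral>\<^sup>+z. ?e (insert j I) (y(j := z)) \<partial>P) \<le> ?e I y * ennreal (exp ?c)"
    if y: "y \<in> space (\<Pi>\<^sub>M j\<in>I. P)" for y
  proof -
    have yS: "y k \<in> space S" if "k \<in> I" for k
      using y that sets_eq_imp_space_eq[OF sP] by (auto simp: space_PiM)
    let ?R = "uniform_mixture N (\<kappa> I y)" and ?Q = "\<lambda>z. uniform_mixture N ((\<kappa> I y)(j := return S z))"
    \<comment> \<open>Drawing the new coordinate \<open>z\<close> is a move of mass \<open>1 / N\<close> from \<open>P\<close> towards \<open>z\<close>.\<close>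
    have \<kappa>j: "\<kappa> (insert j I) (y(j := z)) = (\<kappa> I y)(j := return S z)" for z
      using insert by (auto simp: \<kappa>_def fun_eq_iff)
    have \<kappa>y: "\<kappa> I y k \<in> space (prob_algebra S)" for k
      using yS by (rule \<kappa>_space)
    have R: "?R \<in> space (prob_algebra S)"
      using \<kappa>y by (rule uniform_mixture_in_prob_algebra)
    have Q: "?Q \<in> S \<rightarrow>\<^sub>M prob_algebra S"
    proof (rule measurable_uniform_mixture[OF N])
      show "(\<lambda>z. ((\<kappa> I y)(j := return S z)) k) \<in> S \<rightarrow>\<^sub>M prob_algebra S" for k
        using \<kappa>y[of k] by (cases "k = j") auto
    qed
    have mm: "moved_mass S P (1 / N) z ?R (?Q z)" if "z \<in> space S" for z
    proof -
      have "\<kappa> I y j = P" using insert by (auto simp: \<kappa>_def)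
      then show ?thesis
        using moved_mass_uniform_mixture[OF N _ \<kappa>y that, of j] insert.prems by auto
    qed
    have "(\<integral>\<^sup>+z. ?e (insert j I) (y(j := z)) \<partial>P) =
        ?e I y * (\<integral>\<^sup>+z. ennreal (exp (l * (f (?Q z) - f ?R))) \<partial>P)"
      unfolding \<kappa>j using measurable_compose[OF Q measurable_f]
      by (subst nn_integral_cmult[symmetric])
        (auto simp: ennreal_mult[symmetric] exp_add[symmetric] algebra_simps cong: measurable_cong_sets)
    also have "\<dots> \<le> ?e I y * ennreal (exp (\<bar>l\<bar> * (4 * K * (1 / N)\<^sup>2) + 2 * l\<^sup>2 * K\<^sup>2 * (1 / N)\<^sup>2))"
      by (intro mult_left_mono exp_moment_moved_mass[OF P R _ Q mm]) auto
    finally show ?thesis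
      by (simp add: power_divide)
  qed
  have "(\<integral>\<^sup>+y. ?e (insert j I) y \<partial>(\<Pi>\<^sub>M k\<in>insert j I. P)) =
      (\<integral>\<^sup>+y. \<integral>\<^sup>+z. ?e (insert j I) (y(j := z)) \<partial>P \<partial>(\<Pi>\<^sub>M k\<in>I. P))"
    using insert.hyps meas by (rule product_nn_integral_insert)
  also have "\<dots> \<le> (\<integral>\<^sup>+y. ?e I y * ennreal (exp ?c) \<partial>(\<Pi>\<^sub>M k\<in>I. P))"
    by (intro nn_integral_mono inner)
  also have "\<dots> = (\<integral>\<^sup>+y. ?e I y \<partial>(\<Pi>\<^sub>M k\<in>I. P)) * ennreal (exp ?c)"
    using meas by (rule nn_integral_multc)
  also have "\<dots> \<le> ennreal (exp (\<bar>l\<bar> * (2 * K / N) + card I * ?c)) * ennreal (exp ?c)"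
    using insert by (intro mult_right_mono) auto
  also have "\<dots> = ennreal (exp (\<bar>l\<bar> * (2 * K / N) + card (insert j I) * ?c))"
    using insert.hyps by (simp add: ennreal_mult[symmetric] exp_add[symmetric] distrib_right ac_simps)
  finally show ?case .
qed

end

text \<open>
  The point \<open>X i\<close> enters both as an argument of \<open>F\<close> and as one of the atoms.  Under the product law it is
  integrated out last, so that it is a constant while the other coordinates are averaged.
\<close>

lemma (in prob_space) exp_moment_empirical:
  fixes X :: "nat \<Rightarrow> 'a \<Rightarrow> 'b" and F :: "'b \<Rightarrow> 'b measure \<Rightarrow> real"
  assumes i: "i \<in> {1..N}"
    and X: "\<And>j. j \<in> {1..N} \<Longrightarrow> X j \<in> M \<rightarrow>\<^sub>M S"
    and law: "\<And>j. j \<in> {1..N} \<Longrightarrow> distr M S (X j) = P"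
    and indep: "indep_vars (\<lambda>_. S) X {1..N}"
    and F: "(\<lambda>(x, Q). F x Q) \<in> borel_measurable (S \<Otimes>\<^sub>M prob_algebra S)"
    and flat: "\<And>x. x \<in> space S \<Longrightarrow> second_flat_derivative S (F x) (D x) (D2 x) K"
  shows "(\<integral>\<^sup>+\<omega>. ennreal (exp (l * (F (X i \<omega>) (empirical_measure S N (\<lambda>j. X j \<omega>)) - F (X i \<omega>) P))) \<partial>M)
    \<le> ennreal (exp (\<bar>l\<bar> * (6 * K / N) + 2 * l\<^sup>2 * K\<^sup>2 / N))"
proof -
  have N: "1 \<le> N" using i by simp
  have P: "P \<in> space (prob_algebra S)"
    using prob_space_distr[OF X[OF i]] law[OF i] by (auto simp: space_prob_algebra)
  have sP[measurable_cong]: "sets P = sets S" using P by (simp add: space_prob_algebra)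
  note spP = sets_eq_imp_space_eq[OF sP]
  interpret P: prob_space P using P by (simp add: space_prob_algebra)
  interpret product_sigma_finite "\<lambda>_. P" by standard
  define Y where "Y = (\<lambda>\<omega>. \<lambda>j\<in>{1..N}. X j \<omega>)"
  define \<mu> where "\<mu> y = uniform_mixture N (\<lambda>j. if j \<in> {1..N} then return S (y j) else P)" for y
  define G where "G y = ennreal (exp (l * (F (y i) (\<mu> y) - F (y i) P)))" for y
  have "distr M (\<Pi>\<^sub>M j\<in>{1..N}. S) Y = (\<Pi>\<^sub>M j\<in>{1..N}. distr M S (X j))"
    using indep_vars_iff_distr_eq_PiM'[where I="{1..N}" and M'="\<lambda>_. S" and X=X] i X indep
    by (auto simp: Y_def)
  also have "\<dots> = (\<Pi>\<^sub>M j\<in>{1..N}. P)"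
    using law by (intro PiM_cong) auto
  finally have distrY: "distr M (\<Pi>\<^sub>M j\<in>{1..N}. S) Y = (\<Pi>\<^sub>M j\<in>{1..N}. P)" .
  have Y: "Y \<in> M \<rightarrow>\<^sub>M (\<Pi>\<^sub>M j\<in>{1..N}. S)"
    unfolding Y_def using X by (rule measurable_restrict)
  have \<mu>: "\<mu> \<in> (\<Pi>\<^sub>M j\<in>{1..N}. S) \<rightarrow>\<^sub>M prob_algebra S"
    unfolding \<mu>_def
  proof (rule measurable_uniform_mixture[OF N])
    fix j
    show "(\<lambda>y. if j \<in> {1..N} then return S (y j) else P) \<in> (\<Pi>\<^sub>M j\<in>{1..N}. S) \<rightarrow>\<^sub>M prob_algebra S"
      using P by (cases "j \<in> {1..N}") (auto intro: measurable_compose[OF measurable_component_singleton])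
  qed
  have yi: "(\<lambda>y. y i) \<in> (\<Pi>\<^sub>M j\<in>{1..N}. S) \<rightarrow>\<^sub>M S"
    using i by simp
  have G: "G \<in> borel_measurable (\<Pi>\<^sub>M j\<in>{1..N}. S)"
    unfolding G_def
    using measurable_compose[OF measurable_Pair[OF yi \<mu>] F]
      measurable_compose[OF measurable_Pair[OF yi measurable_const[OF P]] F] by simp
  have "F (X i \<omega>) (empirical_measure S N (\<lambda>j. X j \<omega>)) = F (Y \<omega> i) (\<mu> (Y \<omega>))" if "\<omega> \<in> space M" for \<omega>
  proof -
    have "X j \<omega> \<in> space S" if "j \<in> {1..N}" for j
      using X[OF that] \<open>\<omega> \<in> space M\<close> by (rule measurable_space)
    then have "empirical_measure S N (\<lambda>j. X j \<omega>) = uniform_mixture N (\<lambda>j. if j \<in> {1..N} then return S (X j \<omega>) else P)"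
      by (rule empirical_measure_eq_uniform_mixture[OF N P])
    also have "\<dots> = \<mu> (Y \<omega>)"
      unfolding \<mu>_def Y_def by (intro arg_cong[where f="uniform_mixture N"]) auto
    finally show ?thesis
      using i by (simp add: Y_def)
  qed
  moreover have "X i \<omega> = Y \<omega> i" for \<omega>
    using i by (simp add: Y_def)
  ultimately have "(\<integral>\<^sup>+\<omega>. ennreal (exp (l * (F (X i \<omega>) (empirical_measure S N (\<lambda>j. X j \<omega>)) - F (X i \<omega>) P))) \<partial>M)
      = (\<integral>\<^sup>+\<omega>. G (Y \<omega>) \<partial>M)"
    by (auto simp: G_def intro!: nn_integral_cong)
  also have "\<dots> = (\<integral>\<^sup>+y. G y \<partial>(\<Pi>\<^sub>M j\<in>{1..N}. P))"
    unfolding distrY[symmetric] using Y G by (subst nn_integral_distr) auto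
  also have "\<dots> = (\<integral>\<^sup>+y. G y \<partial>(\<Pi>\<^sub>M j\<in>insert i ({1..N} - {i}). P))"
    using i by (simp add: insert_absorb)
  also have "\<dots> = (\<integral>\<^sup>+x. \<integral>\<^sup>+y. G (y(i := x)) \<partial>(\<Pi>\<^sub>M j\<in>{1..N} - {i}. P) \<partial>P)"
  proof (rule product_nn_integral_insert_rev)
    have "sets (\<Pi>\<^sub>M j\<in>insert i ({1..N} - {i}). P) = sets (\<Pi>\<^sub>M j\<in>{1..N}. S)"
      using i sP by (intro sets_PiM_cong) auto
    with G show "G \<in> borel_measurable (\<Pi>\<^sub>M j\<in>insert i ({1..N} - {i}). P)"
      by (simp cong: measurable_cong_sets)
  qed auto
  also have "\<dots> \<le> (\<integral>\<^sup>+x. ennreal (exp (\<bar>l\<bar> * (6 * K / N) + 2 * l\<^sup>2 * K\<^sup>2 / N)) \<partial>P)"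
  proof (rule nn_integral_mono)
    fix x assume "x \<in> space P"
    then have x: "x \<in> space S" by (simp add: spP)
    interpret second_flat_derivative S "F x" "D x" "D2 x" K
      using x by (rule flat)
    have K: "0 \<le> K"
      using D_bound[OF P x] by linarith
    \<comment> \<open>The mean over the other coordinates, with \<open>X i\<close> frozen at \<open>x\<close>.\<close>
    let ?\<kappa> = "\<lambda>y j. if j = i then return S x else if j \<in> {1..N} - {i} then return S (y j) else P"
    have "(\<lambda>j. if j \<in> {1..N} then return S ((y(i := x)) j) else P) = ?\<kappa> y" for y
      using i by auto
    then have "(\<integral>\<^sup>+y. G (y(i := x)) \<partial>(\<Pi>\<^sub>M j\<in>{1..N} - {i}. P)) =
        (\<integral>\<^sup>+y. ennreal (exp (l * (F x (uniform_mixture N (?\<kappa> y)) - F x P))) \<partial>(\<Pi>\<^sub>M j\<in>{1..N} - {i}. P))"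
      by (simp add: G_def \<mu>_def)
    also have "\<dots> \<le> ennreal (exp (\<bar>l\<bar> * (2 * K / N) +
          card ({1..N} - {i}) * (\<bar>l\<bar> * (4 * K / (real N)\<^sup>2) + 2 * l\<^sup>2 * K\<^sup>2 / (real N)\<^sup>2)))"
      by (rule exp_moment_partial_empirical[OF P x i]) auto
    also have "\<dots> \<le> ennreal (exp (\<bar>l\<bar> * (6 * K / N) + 2 * l\<^sup>2 * K\<^sup>2 / N))"
    proof -
      have "\<bar>l\<bar> * (2 * K / N) + card ({1..N} - {i}) * (\<bar>l\<bar> * (4 * K / (real N)\<^sup>2) + 2 * l\<^sup>2 * K\<^sup>2 / (real N)\<^sup>2)
          \<le> \<bar>l\<bar> * (2 * K / N) + N * (\<bar>l\<bar> * (4 * K / (real N)\<^sup>2) + 2 * l\<^sup>2 * K\<^sup>2 / (real N)\<^sup>2)"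
        using K i by (intro add_left_mono mult_right_mono) auto
      also have "N * (\<bar>l\<bar> * (4 * K / (real N)\<^sup>2) + 2 * l\<^sup>2 * K\<^sup>2 / (real N)\<^sup>2) =
          \<bar>l\<bar> * (4 * K / N) + 2 * l\<^sup>2 * K\<^sup>2 / N"
        using N by (simp add: field_simps power2_eq_square)
      also have "\<bar>l\<bar> * (2 * K / N) + (\<bar>l\<bar> * (4 * K / N) + 2 * l\<^sup>2 * K\<^sup>2 / N) =
          \<bar>l\<bar> * (6 * K / N) + 2 * l\<^sup>2 * K\<^sup>2 / N"
        by (simp add: field_simps)
      finally show ?thesis
        by (simp add: ennreal_leI)
    qed
    finally show "(\<integral>\<^sup>+y. G (y(i := x)) \<partial>(\<Pi>\<^sub>M j\<in>{1..N} - {i}. P))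
      \<le> ennreal (exp (\<bar>l\<bar> * (6 * K / N) + 2 * l\<^sup>2 * K\<^sup>2 / N))" .
  qed
  also have "\<dots> = ennreal (exp (\<bar>l\<bar> * (6 * K / N) + 2 * l\<^sup>2 * K\<^sup>2 / N))"
    by (simp add: P.emeasure_space_1)
  finally show ?thesis .
qed

section \<open>From exponential moments to even moments\<close>

lemma power_le_fact_mult_exp:
  fixes u :: real
  assumes "0 \<le> u"
  shows "u ^ n \<le> fact n * exp u"
proof -
  have "(\<Sum>k\<in>{n}. u ^ k /\<^sub>R fact k) \<le> (\<Sum>k. u ^ k /\<^sub>R fact k)"
    using assms by (intro sum_le_suminf summable_exp_generic) auto
  then have "u ^ n /\<^sub>R fact n \<le> exp u"
    by (simp add: exp_def)
  then show ?thesis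
    by (simp add: field_simps)
qed

lemma even_power_le_fact_mult_cosh:
  fixes u :: real
  shows "u ^ (2 * p) \<le> fact (2 * p) * (exp u + exp (- u))"
proof -
  have "u ^ (2 * p) = \<bar>u\<bar> ^ (2 * p)"
    by (simp add: power_mult)
  also have "\<dots> \<le> fact (2 * p) * exp \<bar>u\<bar>"
    by (rule power_le_fact_mult_exp) simp
  also have "\<dots> \<le> fact (2 * p) * (exp u + exp (- u))"
    by (intro mult_left_mono) (auto simp: abs_if)
  finally show ?thesis .
qed

text \<open>
  From \<open>(2p)! = (p!)\<^sup>2 (2p choose p)\<close>, with \<open>p! \<le> p\<^sup>p\<close> for one of the two factors: the power \<open>p\<^sup>p\<close> is what the choice of
  the exponential parameter in \<open>even_moment_le\<close> cancels.
\<close>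

lemma fact_double_le: "fact (2 * p) \<le> (4 ^ p * fact p * real p ^ p :: real)"
proof -
  have "fact (2 * p) = (fact p * fact p * (2 * p choose p) :: nat)"
    using binomial_fact_lemma[of p "2 * p"] by simp
  also have "\<dots> \<le> fact p * p ^ p * 2 ^ (2 * p)"
    using fact_le_power[of p, where ?'a=nat] binomial_le_pow2[of "2 * p" p]
    by (intro mult_le_mono) auto
  also have "\<dots> = 4 ^ p * fact p * p ^ p"
    by (simp add: power_mult)
  finally have "fact (2 * p) \<le> 4 ^ p * fact p * p ^ p" .
  then have "real (fact (2 * p)) \<le> real (4 ^ p * fact p * p ^ p)"
    by (rule of_nat_mono)
  then show ?thesis by simp
qed

text \<open>
  The exponential parameter \<open>l\<close> with \<open>l\<^sup>2 = p N / K\<^sup>2\<close> makes the quadratic term of the exponent equal to \<open>2 p\<close> and the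
  linear one at most \<open>6 p\<close>, hence the base \<open>exp 8\<close>.
\<close>

lemma even_moment_le:
  fixes Z :: "'a \<Rightarrow> real"
  assumes Z[measurable]: "Z \<in> borel_measurable M" and K: "0 < K" and N: "1 \<le> N" and p: "1 \<le> p"
    and exp_moment: "\<And>l. (\<integral>\<^sup>+\<omega>. ennreal (exp (l * Z \<omega>)) \<partial>M)
      \<le> ennreal (exp (\<bar>l\<bar> * (6 * K / real N) + 2 * l\<^sup>2 * K\<^sup>2 / real N))"
  shows "(\<integral>\<^sup>+\<omega>. ennreal (Z \<omega> ^ (2 * p)) \<partial>M) \<le> ennreal (fact p * (8 * exp 8 * K\<^sup>2 / real N) ^ p)"
proof -
  define l where "l = sqrt (real p * real N) / K"
  \<comment> \<open>As \<open>p N\<close> is at least \<open>1\<close>, its square root can be bounded by \<open>p N\<close> in the linear term.\<close>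
  have pN: "1 \<le> real p * real N"
    using p N mult_mono[of 1 "real p" 1 "real N"] by simp
  have l: "0 < l" "l\<^sup>2 = real p * real N / K\<^sup>2"
    using K pN by (simp_all add: l_def power_divide)
  have "sqrt (real p * real N) \<le> real p * real N"
    using pN by (intro real_le_lsqrt) (auto simp: power2_eq_square intro: mult_left_mono[of 1 _ "real p * real N", simplified])
  then have "l * (6 * K / N) \<le> 6 * p"
    using K N by (simp add: l_def field_simps)
  moreover have "2 * l\<^sup>2 * K\<^sup>2 / N = 2 * p"
    using K N by (simp add: l)
  ultimately have expo: "exp (l * (6 * K / N) + 2 * l\<^sup>2 * K\<^sup>2 / N) \<le> exp 8 ^ p"
    by (simp add: exp_of_nat_mult[symmetric] mult.commute)
  have E: "(\<integral>\<^sup>+\<omega>. ennreal (exp (s * l * Z \<omega>)) \<partial>M) \<le> ennreal (exp 8 ^ p)" if "\<bar>s\<bar> = 1" for s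
  proof -
    have "\<bar>s * l\<bar> = l" "(s * l)\<^sup>2 = l\<^sup>2"
      using that l(1) by (auto simp: abs_mult power_mult_distrib abs_square_eq_1[symmetric])
    then show ?thesis
      using exp_moment[of "s * l"] expo by (auto intro: order_trans ennreal_leI)
  qed
  let ?c = "fact (2 * p) / (l\<^sup>2) ^ p"
  have "(\<integral>\<^sup>+\<omega>. ennreal (Z \<omega> ^ (2 * p)) \<partial>M)
      \<le> (\<integral>\<^sup>+\<omega>. ennreal ?c * (ennreal (exp (1 * l * Z \<omega>)) + ennreal (exp (- 1 * l * Z \<omega>))) \<partial>M)"
  proof (rule nn_integral_mono)
    fix \<omega>
    have "Z \<omega> ^ (2 * p) * (l\<^sup>2) ^ p = (l * Z \<omega>) ^ (2 * p)"
      by (simp add: power_mult_distrib power_mult)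
    also have "\<dots> \<le> fact (2 * p) * (exp (l * Z \<omega>) + exp (- (l * Z \<omega>)))"
      by (rule even_power_le_fact_mult_cosh)
    finally have "Z \<omega> ^ (2 * p) \<le> ?c * (exp (l * Z \<omega>) + exp (- (l * Z \<omega>)))"
      using l(1) by (simp add: field_simps)
    then show "ennreal (Z \<omega> ^ (2 * p))
        \<le> ennreal ?c * (ennreal (exp (1 * l * Z \<omega>)) + ennreal (exp (- 1 * l * Z \<omega>)))"
      by (simp add: ennreal_mult[symmetric] ennreal_plus[symmetric] ennreal_leI del: ennreal_plus)
  qed
  also have "\<dots> = ennreal ?c * ((\<integral>\<^sup>+\<omega>. ennreal (exp (1 * l * Z \<omega>)) \<partial>M) + (\<integral>\<^sup>+\<omega>. ennreal (exp (- 1 * l * Z \<omega>)) \<partial>M))"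
    by (simp add: nn_integral_cmult nn_integral_add)
  also have "\<dots> \<le> ennreal ?c * (ennreal (exp 8 ^ p) + ennreal (exp 8 ^ p))"
    using E[of 1] E[of "-1"] by (intro mult_left_mono add_mono) auto
  also have "\<dots> = ennreal (?c * (2 * exp 8 ^ p))"
    by (simp add: ennreal_mult[symmetric] ennreal_plus[symmetric] del: ennreal_plus)
  also have "\<dots> \<le> ennreal (fact p * (8 * exp 8 * K\<^sup>2 / N) ^ p)"
  proof (rule ennreal_leI)
    have "?c = fact (2 * p) * (K\<^sup>2) ^ p / (real p ^ p * real N ^ p)"
      by (simp add: l power_divide power_mult_distrib)
    also have "\<dots> \<le> (4 ^ p * fact p * real p ^ p) * (K\<^sup>2) ^ p / (real p ^ p * real N ^ p)"
      by (intro divide_right_mono mult_right_mono fact_double_le) auto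
    also have "\<dots> = 4 ^ p * fact p * (K\<^sup>2) ^ p / real N ^ p"
      using p by simp
    finally have "?c * (2 * exp 8 ^ p) \<le> (4 ^ p * fact p * (K\<^sup>2) ^ p / real N ^ p) * (2 ^ p * exp 8 ^ p)"
      using p self_le_power[of "2::real" p] by (intro mult_mono) auto
    also have "\<dots> = fact p * (8 * exp 8 * K\<^sup>2 / N) ^ p"
      using power_mult_distrib[of "4::real" 2 p]
      by (simp add: power_mult_distrib power_divide)
    finally show "?c * (2 * exp 8 ^ p) \<le> fact p * (8 * exp 8 * K\<^sup>2 / N) ^ p" .
  qed
  finally show ?thesis .
qed

section \<open>Moments of time integrals\<close>

text \<open>
  The power mean inequality for the counting measure on the set of components.
\<close>

lemma norm_power2_power_le:
  fixes v :: "real ^ 'm"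
  assumes p: "1 \<le> p"
  shows "ennreal ((norm v)\<^sup>2) ^ p \<le> of_nat CARD('m) ^ (p - 1) * (\<Sum>l\<in>UNIV. ennreal (v $ l ^ (2 * p)))"
proof -
  have "(norm v)\<^sup>2 = (\<Sum>l\<in>UNIV. (v $ l)\<^sup>2)"
    unfolding power2_norm_eq_inner inner_vec_def by (simp add: power2_eq_square)
  then have "ennreal ((norm v)\<^sup>2) = (\<integral>\<^sup>+l. ennreal ((v $ l)\<^sup>2) \<partial>count_space UNIV)"
    by (simp add: nn_integral_count_space_finite)
  then have "ennreal ((norm v)\<^sup>2) ^ p \<le> emeasure (count_space UNIV) (space (count_space (UNIV :: 'm set))) ^ (p - 1) *
      (\<integral>\<^sup>+l. ennreal ((v $ l)\<^sup>2) ^ p \<partial>count_space UNIV)"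
    by (simp only:) (rule nn_integral_power_le[OF _ p], simp)
  then show ?thesis
    by (simp add: nn_integral_count_space_finite ennreal_power power_mult)
qed

lemma time_integral_moment_le:
  fixes V :: "real \<Rightarrow> 'w \<Rightarrow> real ^ 'm"
  assumes M: "sigma_finite_measure M" and p: "1 \<le> p" and ab: "a \<le> b" "b - a \<le> \<delta>" and C: "0 \<le> C"
    and V: "\<And>l. (\<lambda>(t, \<omega>). V t \<omega> $ l) \<in> borel_measurable (restrict_space borel {a..b} \<Otimes>\<^sub>M M)"
    and moment: "\<And>t l. t \<in> {a..b} \<Longrightarrow> (\<integral>\<^sup>+\<omega>. ennreal (V t \<omega> $ l ^ (2 * p)) \<partial>M) \<le> ennreal C"
  shows "(\<integral>\<^sup>+\<omega>. (\<integral>\<^sup>+t\<in>{a..b}. ennreal ((norm (V t \<omega>))\<^sup>2) \<partial>lborel) ^ p \<partial>M)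
    \<le> ennreal (\<delta> ^ p * real CARD('m) ^ p * C)"
proof -
  interpret M: sigma_finite_measure M by (rule M)
  define L where "L = restrict_space lborel {a..b}"
  have spL: "space L = {a..b}"
    by (simp add: L_def space_restrict_space)
  have emL: "emeasure L (space L) = ennreal (b - a)"
    using ab by (simp add: spL L_def emeasure_restrict_space)
  have [measurable_cong]: "sets L = sets (restrict_space borel {a..b})"
    unfolding L_def by (intro sets_restrict_space_cong) simp
  interpret L: finite_measure L
    by (rule finite_measureI) (simp add: emL)
  interpret pair_sigma_finite L M by unfold_locales
  have V'[measurable]: "(\<lambda>(t, \<omega>). V t \<omega> $ l) \<in> borel_measurable (L \<Otimes>\<^sub>M M)" for l
    using V[of l] by (simp cong: measurable_cong_sets)
  define g where "g t \<omega> = (\<Sum>l\<in>UNIV. ennreal (V t \<omega> $ l ^ (2 * p)))" for t \<omega>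
  have Vl[measurable]: "(\<lambda>z. V (fst z) (snd z) $ l) \<in> borel_measurable (L \<Otimes>\<^sub>M M)" for l
    using V'[of l] by (simp add: split_beta')
  have g[measurable]: "(\<lambda>(t, \<omega>). g t \<omega>) \<in> borel_measurable (L \<Otimes>\<^sub>M M)"
    unfolding g_def split_beta' by measurable
  have gM: "(\<lambda>\<omega>. \<integral>\<^sup>+t. g t \<omega> \<partial>L) \<in> borel_measurable M"
    using measurable_pair_swap[OF g] by (intro L.borel_measurable_nn_integral) (simp add: split_beta')
  have VL: "(\<lambda>t. V t \<omega> $ l) \<in> borel_measurable L" if "\<omega> \<in> space M" for \<omega> l
    using measurable_compose[OF measurable_Pair2'[OF that] V'] by simp
  have normL: "(\<lambda>t. ennreal ((norm (V t \<omega>))\<^sup>2)) \<in> borel_measurable L" if "\<omega> \<in> space M" for \<omega>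
  proof -
    have "(norm (V t \<omega>))\<^sup>2 = (\<Sum>l\<in>UNIV. (V t \<omega> $ l)\<^sup>2)" for t
      unfolding power2_norm_eq_inner inner_vec_def by (simp add: power2_eq_square)
    then show ?thesis
      using VL[OF that] by simp
  qed
  have gL: "(\<lambda>t. g t \<omega>) \<in> borel_measurable L" if "\<omega> \<in> space M" for \<omega>
    unfolding g_def using VL[OF that] by simp
  let ?m = "of_nat CARD('m) :: ennreal"
  have "(\<integral>\<^sup>+\<omega>. (\<integral>\<^sup>+t\<in>{a..b}. ennreal ((norm (V t \<omega>))\<^sup>2) \<partial>lborel) ^ p \<partial>M) =
      (\<integral>\<^sup>+\<omega>. (\<integral>\<^sup>+t. ennreal ((norm (V t \<omega>))\<^sup>2) \<partial>L) ^ p \<partial>M)"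
    unfolding L_def by (subst nn_integral_restrict_space) auto
  also have "\<dots> \<le> (\<integral>\<^sup>+\<omega>. ennreal (b - a) ^ (p - 1) * (?m ^ (p - 1) * (\<integral>\<^sup>+t. g t \<omega> \<partial>L)) \<partial>M)"
  proof (rule nn_integral_mono)
    fix \<omega> assume \<omega>: "\<omega> \<in> space M"
    have "(\<integral>\<^sup>+t. ennreal ((norm (V t \<omega>))\<^sup>2) \<partial>L) ^ p
        \<le> ennreal (b - a) ^ (p - 1) * (\<integral>\<^sup>+t. ennreal ((norm (V t \<omega>))\<^sup>2) ^ p \<partial>L)"
      using nn_integral_power_le[OF normL[OF \<omega>] p] unfolding emL .
    also have "\<dots> \<le> ennreal (b - a) ^ (p - 1) * (\<integral>\<^sup>+t. ?m ^ (p - 1) * g t \<omega> \<partial>L)"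
      unfolding g_def by (intro mult_left_mono nn_integral_mono norm_power2_power_le p) simp
    finally show "(\<integral>\<^sup>+t. ennreal ((norm (V t \<omega>))\<^sup>2) \<partial>L) ^ p
        \<le> ennreal (b - a) ^ (p - 1) * (?m ^ (p - 1) * (\<integral>\<^sup>+t. g t \<omega> \<partial>L))"
      using gL[OF \<omega>] by (simp add: nn_integral_cmult)
  qed
  also have "\<dots> = ennreal (b - a) ^ (p - 1) * (?m ^ (p - 1) * (\<integral>\<^sup>+\<omega>. \<integral>\<^sup>+t. g t \<omega> \<partial>L \<partial>M))"
    using gM by (simp add: nn_integral_cmult)
  also have "(\<integral>\<^sup>+\<omega>. \<integral>\<^sup>+t. g t \<omega> \<partial>L \<partial>M) = (\<integral>\<^sup>+t. \<integral>\<^sup>+\<omega>. g t \<omega> \<partial>M \<partial>L)"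
    using g by (rule Fubini')
  also have "\<dots> \<le> (\<integral>\<^sup>+t. ?m * ennreal C \<partial>L)"
  proof (rule nn_integral_mono)
    fix t assume t: "t \<in> space L"
    have "(\<lambda>\<omega>. V t \<omega> $ l) \<in> borel_measurable M" for l
      using measurable_compose[OF measurable_Pair1'[OF t] V'] by simp
    then have "(\<integral>\<^sup>+\<omega>. g t \<omega> \<partial>M) = (\<Sum>l\<in>UNIV. \<integral>\<^sup>+\<omega>. ennreal (V t \<omega> $ l ^ (2 * p)) \<partial>M)"
      unfolding g_def by (intro nn_integral_sum) simp
    also have "\<dots> \<le> (\<Sum>l\<in>(UNIV :: 'm set). ennreal C)"
      using t by (intro sum_mono moment) (simp add: spL)
    finally show "(\<integral>\<^sup>+\<omega>. g t \<omega> \<partial>M) \<le> ?m * ennreal C"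
      by simp
  qed
  also have "\<dots> = ?m * ennreal C * ennreal (b - a)"
    by (simp add: emL)
  also have "ennreal (b - a) ^ (p - 1) * (?m ^ (p - 1) * (?m * ennreal C * ennreal (b - a))) =
      ennreal (b - a) ^ Suc (p - 1) * ?m ^ Suc (p - 1) * ennreal C"
    by (simp add: ac_simps)
  also have "\<dots> = ennreal ((b - a) ^ p * real CARD('m) ^ p * C)"
    using p ab C by (simp add: ennreal_of_nat_eq_real_of_nat ennreal_power ennreal_mult del: power_Suc)
  also have "\<dots> \<le> ennreal (\<delta> ^ p * real CARD('m) ^ p * C)"
    using ab C by (intro ennreal_leI mult_right_mono power_mono) auto
  finally show ?thesis
    by (simp add: mult_left_mono)
qed

section \<open>Laws of paths on different time horizons\<close>

lemma space_path_space: "space (path_space I) = paths I"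
  unfolding path_space_def by (rule space_measure_of) (auto simp: open_paths_def)

lemma restrict_in_paths:
  assumes "x \<in> paths I" "J \<subseteq> I"
  shows "restrict x J \<in> paths J"
proof -
  have "continuous_on J x"
    using assms by (auto simp: paths_def intro: continuous_on_subset)
  then have "continuous_on J (restrict x J)"
    by (rule continuous_on_eq) simp
  then show ?thesis
    by (simp add: paths_def)
qed

lemma restrict_paths_id: "x \<in> paths I \<Longrightarrow> restrict x I = x"
  by (simp add: paths_def extensional_restrict)

text \<open>
  Restriction is continuous: a compact subset of the smaller time set is one of the larger time set.
\<close>

lemma measurable_restrict_path:
  assumes "J \<subseteq> I"
  shows "(\<lambda>x. restrict x J) \<in> path_space I \<rightarrow>\<^sub>M path_space J"
  unfolding path_space_def[of J]
proof (rule measurable_measure_of)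
  show "{U. open_paths J U} \<subseteq> Pow (paths J)"
    by (auto simp: open_paths_def)
  show "(\<lambda>x. restrict x J) \<in> space (path_space I) \<rightarrow> paths J"
    using assms by (auto simp: space_path_space restrict_in_paths)
  fix U :: "'a path set" assume "U \<in> {U. open_paths J U}"
  then have U: "open_paths J U" by simp
  have "open_paths I ((\<lambda>x. restrict x J) -` U \<inter> paths I)"
    unfolding open_paths_def
  proof (intro conjI ballI)
    fix x assume x: "x \<in> (\<lambda>x. restrict x J) -` U \<inter> paths I"
    then have "restrict x J \<in> U" by simp
    from bspec[OF conjunct2[OF U[unfolded open_paths_def]] this]
    obtain K e where K: "compact K" "K \<subseteq> J" "0 < e"
      and e: "\<And>y. y \<in> paths J \<Longrightarrow> \<forall>s\<in>K. dist (restrict x J s) (y s) < e \<Longrightarrow> y \<in> U"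
      by auto
    have "y \<in> (\<lambda>x. restrict x J) -` U \<inter> paths I"
      if y: "y \<in> paths I" and d: "\<forall>s\<in>K. dist (x s) (y s) < e" for y
    proof -
      have "restrict y J \<in> U"
        using K(2) d restrict_in_paths[OF y assms] by (intro e) auto
      with y show ?thesis by simp
    qed
    then show "\<exists>K e. compact K \<and> K \<subseteq> I \<and> 0 < e \<and>
        (\<forall>y\<in>paths I. (\<forall>s\<in>K. dist (x s) (y s) < e) \<longrightarrow> y \<in> (\<lambda>x. restrict x J) -` U \<inter> paths I)"
      using K assms by (intro exI[of _ K] exI[of _ e]) auto
  qed auto
  then show "(\<lambda>x. restrict x J) -` U \<inter> space (path_space I) \<in> sets (path_space I)"
    unfolding space_path_space unfolding path_space_def
    by (subst sets_measure_of) (auto simp: open_paths_def)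
qed

lemma law_upto_eq_distr:
  assumes X: "X \<in> M \<rightarrow>\<^sub>M path_space {0..T}" and t: "t \<le> T"
  shows "law_upto M X t =
    distr (distr M (path_space {0..T}) X) (path_space {0..t}) (\<lambda>x. restrict x {0..t})"
proof -
  have "{0..t} \<subseteq> {0..T}" using t by auto
  then show ?thesis
    unfolding law_upto_def
    by (subst distr_distr[OF measurable_restrict_path X]) (auto simp: comp_def)
qed

lemma empirical_upto_eq_distr:
  assumes X: "\<And>j. j \<in> {1..N} \<Longrightarrow> X j \<omega> \<in> paths {0..T}" and t: "t \<le> T"
  shows "empirical_upto N X \<omega> t =
    distr (empirical_measure (path_space {0..T}) N (\<lambda>j. X j \<omega>)) (path_space {0..t}) (\<lambda>x. restrict x {0..t})"
proof (rule measure_eqI)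
  let ?E = "empirical_measure (path_space {0..T}) N (\<lambda>j. X j \<omega>)"
  have sub: "{0..t} \<subseteq> {0..T}" using t by auto
  have sE: "sets ?E = sets (path_space {0..T})" and spE: "space ?E = paths {0..T}"
    by (simp_all add: space_path_space)
  show "sets (empirical_upto N X \<omega> t) = sets (distr ?E (path_space {0..t}) (\<lambda>x. restrict x {0..t}))"
    by (simp add: empirical_upto_def)
  fix U assume "U \<in> sets (empirical_upto N X \<omega> t)"
  then have U: "U \<in> sets (path_space {0..t})"
    by (simp add: empirical_upto_def)
  have meas: "(\<lambda>x. restrict x {0..t}) \<in> ?E \<rightarrow>\<^sub>M path_space {0..t}"
    using measurable_restrict_path[OF sub] by (simp add: sE cong: measurable_cong_sets)
  have V: "(\<lambda>x. restrict x {0..t}) -` U \<inter> paths {0..T} \<in> sets (path_space {0..T})"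
    using measurable_sets[OF measurable_restrict_path[OF sub] U] by (simp add: space_path_space)
  have "emeasure (distr ?E (path_space {0..t}) (\<lambda>x. restrict x {0..t})) U =
      (\<Sum>j=1..N. indicator ((\<lambda>x. restrict x {0..t}) -` U \<inter> paths {0..T}) (X j \<omega>)) / of_nat N"
    using meas U V by (simp add: emeasure_distr space_path_space emeasure_empirical_measure)
  also have "\<dots> = (\<Sum>j=1..N. indicator U (restrict (X j \<omega>) {0..t})) / of_nat N"
    using X by (intro arg_cong2[where f="(/)"] sum.cong) (auto simp: indicator_def)
  also have "\<dots> = emeasure (empirical_upto N X \<omega> t) U"
    using U by (simp add: empirical_upto_def emeasure_empirical_measure)
  finally show "emeasure (empirical_upto N X \<omega> t) U =
      emeasure (distr ?E (path_space {0..t}) (\<lambda>x. restrict x {0..t})) U" ..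
qed

text \<open>
  Both sides are the value of \<open>B\<close> at the path and the law restricted to \<open>{0..t}\<close>, since restricting twice is
  restricting once.
\<close>

lemma path_law_coefficient_stopped:
  assumes B: "path_law_coefficient B" and t: "t \<in> {0..T}" and x: "x \<in> paths {0..T}"
    and Q: "Q \<in> space (prob_algebra (path_space {0..T}))"
  shows "B t x (distr Q (path_space {0..t}) (\<lambda>x. restrict x {0..t})) = B t x Q"
proof -
  let ?Q = "distr Q (path_space {0..t}) (\<lambda>x. restrict x {0..t})"
  have hor: "{0..T} \<in> horizons" "{0..t} \<in> horizons"
    using t by (auto simp: horizons_def)
  have nonant: "B t x R = B t (restrict x {0..t}) (distr R (path_space {0..t}) (\<lambda>x. restrict x {0..t}))"
    if "J \<in> horizons" "t \<in> J" "R \<in> space (prob_algebra (path_space J))" for J R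
    using B hor(1) t x that unfolding path_law_coefficient_def by blast
  interpret Q: prob_space Q using Q by (simp add: space_prob_algebra)
  have "(\<lambda>x. restrict x {0..t}) \<in> Q \<rightarrow>\<^sub>M path_space {0..t}"
    using measurable_restrict_path[of "{0..t}" "{0..T}"] Q t
    by (auto simp: space_prob_algebra cong: measurable_cong_sets)
  then have Q': "?Q \<in> space (prob_algebra (path_space {0..t}))"
    by (simp add: space_prob_algebra Q.prob_space_distr)
  have "distr ?Q (path_space {0..t}) (\<lambda>x. restrict x {0..t}) = distr ?Q (path_space {0..t}) (\<lambda>x. x)"
    by (rule distr_cong) (auto simp: space_path_space restrict_paths_id)
  also have "\<dots> = ?Q"
    by (rule distr_id2) simp
  finally show ?thesis
    using nonant[OF hor(2) _ Q'] nonant[OF hor(1) t Q] t by simp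
qed

section \<open>The error along the limit system\<close>

text \<open>
  At each time the error \<open>delta_B\<close> is stated with laws of paths on \<open>{0..t}\<close>, a space that varies with \<open>t\<close>.  It is
  first rewritten with laws on the fixed space of paths on \<open>{0..T}\<close>, because Fubini's theorem needs
  measurability jointly in the time and the sample point.
\<close>

lemma delta_B_moment_le:
  fixes B :: "real \<Rightarrow> (real^'d) path \<Rightarrow> (real^'d) path measure \<Rightarrow> real^'m"
    and X :: "nat \<Rightarrow> 'w \<Rightarrow> (real^'d) path"
  assumes B: "path_law_coefficient B" and K: "0 < K" and T: "0 \<le> T"
    and flat: "\<And>l. \<exists>D D2. \<forall>t\<in>{0..T}. \<forall>x\<in>paths {0..T}.
      second_flat_derivative (path_space {0..T}) (\<lambda>Q. B t x Q $ l) (D t x) (D2 t x) K"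
    and M: "prob_space M" and i: "i \<in> {1..N}" and p: "1 \<le> p"
    and X: "\<And>j. j \<in> {1..N} \<Longrightarrow> X j \<in> M \<rightarrow>\<^sub>M path_space {0..T}"
    and law: "\<And>j. j \<in> {1..N} \<Longrightarrow> distr M (path_space {0..T}) (X j) = distr M (path_space {0..T}) (X i)"
    and indep: "prob_space.indep_vars M (\<lambda>_. path_space {0..T}) X {1..N}"
    and ab: "0 \<le> a" "a \<le> b" "b \<le> T" "b - a \<le> \<delta>"
  shows "(\<integral>\<^sup>+\<omega>. (\<integral>\<^sup>+t\<in>{a..b}. ennreal ((norm (delta_B B M N X i t \<omega>))\<^sup>2) \<partial>lborel) ^ p \<partial>M)
    \<le> ennreal (\<delta> ^ p * real CARD('m) ^ p * (fact p * (8 * exp 8 * K\<^sup>2 / real N) ^ p))"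
proof -
  interpret M: prob_space M by (rule M)
  let ?S = "path_space {0..T} :: (real^'d) path measure"
  define P where "P = distr M ?S (X i)"
  define E where "E \<omega> = empirical_measure ?S N (\<lambda>j. X j \<omega>)" for \<omega>
  define V where "V t \<omega> = B t (X i \<omega>) (E \<omega>) - B t (X i \<omega>) P" for t \<omega>
  have N: "1 \<le> N" using i by simp
  have P: "P \<in> space (prob_algebra ?S)"
    using M.prob_space_distr[OF X[OF i]] by (simp add: P_def space_prob_algebra)
  have E: "E \<in> M \<rightarrow>\<^sub>M prob_algebra ?S"
    unfolding E_def using N X by (rule measurable_empirical_measure)
  have paths: "X j \<omega> \<in> paths {0..T}" if "j \<in> {1..N}" "\<omega> \<in> space M" for j \<omega>
    using measurable_space[OF X[OF that(1)] that(2)] by (simp add: space_path_space)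
  have delta: "delta_B B M N X i t \<omega> = V t \<omega>" if t: "t \<in> {0..T}" and \<omega>: "\<omega> \<in> space M" for t \<omega>
  proof -
    have 1: "empirical_upto N X \<omega> t = distr (E \<omega>) (path_space {0..t}) (\<lambda>x. restrict x {0..t})"
      unfolding E_def using t \<omega> paths by (intro empirical_upto_eq_distr) auto
    have 2: "law_upto M (X i) t = distr P (path_space {0..t}) (\<lambda>x. restrict x {0..t})"
      unfolding P_def using t X[OF i] by (intro law_upto_eq_distr) auto
    show ?thesis
      unfolding delta_B_def V_def 1 2
      using path_law_coefficient_stopped[OF B t paths[OF i \<omega>] measurable_space[OF E \<omega>]]
        path_law_coefficient_stopped[OF B t paths[OF i \<omega>] P] by simp
  qed
  have Bm: "(\<lambda>(t, x, Q). B t x Q)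
      \<in> restrict_space borel {0..T} \<Otimes>\<^sub>M ?S \<Otimes>\<^sub>M prob_algebra ?S \<rightarrow>\<^sub>M borel"
    using B T unfolding path_law_coefficient_def by auto
  have nth: "(\<lambda>v :: real^'m. v $ l) \<in> borel_measurable borel" for l
    by simp
  have Bl: "(\<lambda>z. B (u z) (x z) (Q z) $ l) \<in> borel_measurable L"
    if "u \<in> L \<rightarrow>\<^sub>M restrict_space borel {0..T}" "x \<in> L \<rightarrow>\<^sub>M ?S" "Q \<in> L \<rightarrow>\<^sub>M prob_algebra ?S"
    for u x Q l and L :: "'z measure"
    using measurable_compose[OF measurable_compose[OF measurable_Pair[OF that(1) measurable_Pair[OF that(2,3)]] Bm] nth]
    by simp
  have "(\<integral>\<^sup>+\<omega>. (\<integral>\<^sup>+t\<in>{a..b}. ennreal ((norm (delta_B B M N X i t \<omega>))\<^sup>2) \<partial>lborel) ^ p \<partial>M) =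
      (\<integral>\<^sup>+\<omega>. (\<integral>\<^sup>+t\<in>{a..b}. ennreal ((norm (V t \<omega>))\<^sup>2) \<partial>lborel) ^ p \<partial>M)"
    using ab by (intro nn_integral_cong arg_cong[where f="\<lambda>u. u ^ p"])
      (auto simp: delta indicator_def)
  also have "\<dots> \<le> ennreal (\<delta> ^ p * real CARD('m) ^ p * (fact p * (8 * exp 8 * K\<^sup>2 / real N) ^ p))"
  proof (rule time_integral_moment_le[OF M.sigma_finite_measure_axioms p ab(2,4)])
    show "0 \<le> fact p * (8 * exp 8 * K\<^sup>2 / real N) ^ p" by simp
    fix l
    let ?L = "restrict_space borel {a..b} \<Otimes>\<^sub>M M"
    have u: "fst \<in> ?L \<rightarrow>\<^sub>M restrict_space borel {0..T}"
      using ab by (intro measurable_compose[OF measurable_fst] measurable_restrict_space2 measurable_restrict_space1)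
        (auto simp: space_restrict_space)
    have Xi: "(\<lambda>z. X i (snd z)) \<in> ?L \<rightarrow>\<^sub>M ?S"
      using measurable_compose[OF measurable_snd X[OF i]] .
    have E': "(\<lambda>z. E (snd z)) \<in> ?L \<rightarrow>\<^sub>M prob_algebra ?S"
      using measurable_compose[OF measurable_snd E] .
    show "(\<lambda>(t, \<omega>). V t \<omega> $ l) \<in> borel_measurable ?L"
      unfolding V_def split_beta' vector_minus_component
      using Bl[OF u Xi E'] Bl[OF u Xi measurable_const[OF P]] by (rule borel_measurable_diff)
  next
    fix t :: real and l :: 'm assume "t \<in> {a..b}"
    then have t: "t \<in> {0..T}" using ab by auto
    obtain D D2 where fl: "\<And>x. x \<in> paths {0..T} \<Longrightarrow>
        second_flat_derivative ?S (\<lambda>Q. B t x Q $ l) (D t x) (D2 t x) K"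
      using flat[of l] t by blast
    have ct: "(\<lambda>_. t) \<in> L \<rightarrow>\<^sub>M restrict_space borel {0..T}" for L :: "'z measure"
      using t by (intro measurable_const) (simp add: space_restrict_space)
    show "(\<integral>\<^sup>+\<omega>. ennreal (V t \<omega> $ l ^ (2 * p)) \<partial>M) \<le> ennreal (fact p * (8 * exp 8 * K\<^sup>2 / real N) ^ p)"
    proof (rule even_moment_le[OF _ K N p])
      show "(\<lambda>\<omega>. V t \<omega> $ l) \<in> borel_measurable M"
        unfolding V_def vector_minus_component
        using Bl[OF ct X[OF i] E] Bl[OF ct X[OF i] measurable_const[OF P]] by (rule borel_measurable_diff)
      show "(\<integral>\<^sup>+\<omega>. ennreal (exp (r * (V t \<omega> $ l))) \<partial>M)
          \<le> ennreal (exp (\<bar>r\<bar> * (6 * K / real N) + 2 * r\<^sup>2 * K\<^sup>2 / real N))" for r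
        unfolding V_def E_def vector_minus_component
      proof (rule M.exp_moment_empirical[OF i X _ indep, where F="\<lambda>x Q. B t x Q $ l" and D="D t" and ?D2.0="D2 t"])
        show "distr M ?S (X j) = P" if "j \<in> {1..N}" for j
          unfolding P_def using that by (rule law)
        show "(\<lambda>(x, Q). B t x Q $ l) \<in> borel_measurable (?S \<Otimes>\<^sub>M prob_algebra ?S)"
          unfolding split_beta' by (rule Bl[OF ct measurable_fst measurable_snd])
        show "second_flat_derivative ?S (\<lambda>Q. B t x Q $ l) (D t x) (D2 t x) K" if "x \<in> space ?S" for x
          using that by (intro fl) (simp add: space_path_space)
      qed auto
    qed
  qed
  finally show ?thesis .
qed

text \<open>
  The bound is enlarged to \<open>\<bar>K0\<bar> + 1\<close> so that it is positive: later it occurs as a divisor.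
\<close>

lemma second_flat_derivative_coefficient:
  fixes B :: "real \<Rightarrow> (real^'d) path \<Rightarrow> (real^'d) path measure \<Rightarrow> real^'m"
  assumes B: "path_law_coefficient B" and flat: "bounded_second_flat_derivative B"
  obtains K where "0 < K" "\<And>T l. 0 < T \<Longrightarrow> \<exists>D D2. \<forall>t\<in>{0..T}. \<forall>x\<in>paths {0..T}.
    second_flat_derivative (path_space {0..T}) (\<lambda>Q. B t x Q $ l) (D t x) (D2 t x) K"
proof -
  from flat obtain K0 where K0: "\<And>l T. 0 < T \<Longrightarrow> \<exists>D D2.
        (\<lambda>(t, x, P, \<omega>). D t x P \<omega>)
          \<in> restrict_space borel {0..T} \<Otimes>\<^sub>M path_space {0..T} \<Otimes>\<^sub>M prob_algebra (path_space {0..T})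
             \<Otimes>\<^sub>M path_space {0..T} \<rightarrow>\<^sub>M borel \<and>
        (\<lambda>(t, x, P, \<omega>, \<omega>'). D2 t x P \<omega> \<omega>')
          \<in> restrict_space borel {0..T} \<Otimes>\<^sub>M path_space {0..T} \<Otimes>\<^sub>M prob_algebra (path_space {0..T})
             \<Otimes>\<^sub>M path_space {0..T} \<Otimes>\<^sub>M path_space {0..T} \<rightarrow>\<^sub>M borel \<and>
        (\<forall>t\<in>{0..T}. \<forall>x\<in>paths {0..T}. \<forall>P\<in>space (prob_algebra (path_space {0..T})).
           \<forall>\<omega>\<in>paths {0..T}. \<forall>\<omega>'\<in>paths {0..T}. \<bar>D t x P \<omega>\<bar> \<le> K0 \<and> \<bar>D2 t x P \<omega> \<omega>'\<bar> \<le> K0) \<and>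
        (\<forall>t\<in>{0..T}. \<forall>x\<in>paths {0..T}. \<forall>\<omega>\<in>paths {0..T}.
           \<forall>P\<in>space (prob_algebra (path_space {0..T})). \<forall>Q\<in>space (prob_algebra (path_space {0..T})).
             B t x Q $ l - B t x P $ l =
               (LINT \<alpha>:{0..1}|lborel.
                  (\<integral>\<omega>'. D t x (mix_measure \<alpha> P Q) \<omega>' \<partial>Q) - (\<integral>\<omega>'. D t x (mix_measure \<alpha> P Q) \<omega>' \<partial>P)) \<and>
             D t x Q \<omega> - D t x P \<omega> =
               (LINT \<alpha>:{0..1}|lborel.
                  (\<integral>\<omega>'. D2 t x (mix_measure \<alpha> P Q) \<omega> \<omega>' \<partial>Q) -
                  (\<integral>\<omega>'. D2 t x (mix_measure \<alpha> P Q) \<omega> \<omega>' \<partial>P)))"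
    unfolding bounded_second_flat_derivative_def by blast
  have "\<exists>D D2. \<forall>t\<in>{0..T}. \<forall>x\<in>paths {0..T}.
    second_flat_derivative (path_space {0..T}) (\<lambda>Q. B t x Q $ l) (D t x) (D2 t x) (\<bar>K0\<bar> + 1)"
    if T: "0 < T" for T l
  proof -
    let ?S = "path_space {0..T} :: (real^'d) path measure"
    from K0[OF T, of l] obtain D D2 where D:
        "(\<lambda>(t, x, P, \<omega>). D t x P \<omega>)
          \<in> restrict_space borel {0..T} \<Otimes>\<^sub>M ?S \<Otimes>\<^sub>M prob_algebra ?S \<Otimes>\<^sub>M ?S \<rightarrow>\<^sub>M borel"
      and D2: "(\<lambda>(t, x, P, \<omega>, \<omega>'). D2 t x P \<omega> \<omega>')
          \<in> restrict_space borel {0..T} \<Otimes>\<^sub>M ?S \<Otimes>\<^sub>M prob_algebra ?S \<Otimes>\<^sub>M ?S \<Otimes>\<^sub>M ?S \<rightarrow>\<^sub>M borel"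
      and bnd: "\<forall>t\<in>{0..T}. \<forall>x\<in>paths {0..T}. \<forall>P\<in>space (prob_algebra ?S).
           \<forall>\<omega>\<in>paths {0..T}. \<forall>\<omega>'\<in>paths {0..T}. \<bar>D t x P \<omega>\<bar> \<le> K0 \<and> \<bar>D2 t x P \<omega> \<omega>'\<bar> \<le> K0"
      and diff: "\<forall>t\<in>{0..T}. \<forall>x\<in>paths {0..T}. \<forall>\<omega>\<in>paths {0..T}.
           \<forall>P\<in>space (prob_algebra ?S). \<forall>Q\<in>space (prob_algebra ?S).
             B t x Q $ l - B t x P $ l =
               (LINT \<alpha>:{0..1}|lborel.
                  (\<integral>\<omega>'. D t x (mix_measure \<alpha> P Q) \<omega>' \<partial>Q) - (\<integral>\<omega>'. D t x (mix_measure \<alpha> P Q) \<omega>' \<partial>P)) \<and>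
             D t x Q \<omega> - D t x P \<omega> =
               (LINT \<alpha>:{0..1}|lborel.
                  (\<integral>\<omega>'. D2 t x (mix_measure \<alpha> P Q) \<omega> \<omega>' \<partial>Q) -
                  (\<integral>\<omega>'. D2 t x (mix_measure \<alpha> P Q) \<omega> \<omega>' \<partial>P))"
      by (elim exE conjE) (rule that)
    have "second_flat_derivative ?S (\<lambda>Q. B t x Q $ l) (D t x) (D2 t x) (\<bar>K0\<bar> + 1)"
      if t: "t \<in> {0..T}" and x: "x \<in> paths {0..T}" for t x
    proof
      have t': "t \<in> space (restrict_space borel {0..T})" and x': "x \<in> space ?S"
        using t x by (simp_all add: space_restrict_space space_path_space)
      have Bm: "(\<lambda>(t, x, Q). B t x Q)
          \<in> restrict_space borel {0..T} \<Otimes>\<^sub>M ?S \<Otimes>\<^sub>M prob_algebra ?S \<rightarrow>\<^sub>M borel"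
        using B T unfolding path_law_coefficient_def by auto
      have "(\<lambda>Q. B t x Q) \<in> prob_algebra ?S \<rightarrow>\<^sub>M borel"
        using measurable_compose[OF measurable_Pair[OF measurable_const[OF t']
          measurable_Pair[OF measurable_const[OF x'] measurable_ident]] Bm] by simp
      from measurable_compose[OF this, of "\<lambda>v. v $ l" borel]
      show "(\<lambda>Q. B t x Q $ l) \<in> borel_measurable (prob_algebra ?S)" by simp
      show "(\<lambda>(P, w). D t x P w) \<in> borel_measurable (prob_algebra ?S \<Otimes>\<^sub>M ?S)"
        using measurable_compose[OF measurable_Pair[OF measurable_const[OF t']
          measurable_Pair[OF measurable_const[OF x'] measurable_ident]] D] by (simp add: split_beta')
      show "D2 t x P w \<in> borel_measurable ?S" if "P \<in> space (prob_algebra ?S)" "w \<in> space ?S" for P w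
        using measurable_compose[OF measurable_Pair[OF measurable_const[OF t']
          measurable_Pair[OF measurable_const[OF x'] measurable_Pair[OF measurable_const[OF that(1)]
          measurable_Pair[OF measurable_const[OF that(2)] measurable_ident]]]] D2] by simp
      fix P assume P: "P \<in> space (prob_algebra ?S)"
      have b: "\<bar>D t x P w\<bar> \<le> K0 \<and> \<bar>D2 t x P w w'\<bar> \<le> K0" if "w \<in> space ?S" "w' \<in> space ?S" for w w'
        using bnd t x P that unfolding space_path_space by blast
      show "\<bar>D t x P w\<bar> \<le> \<bar>K0\<bar> + 1" if "w \<in> space ?S" for w
        using b[OF that that] by linarith
      show "\<bar>D2 t x P w w'\<bar> \<le> \<bar>K0\<bar> + 1" if "w \<in> space ?S" "w' \<in> space ?S" for w w'
        using b[OF that] by linarith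
      fix Q assume Q: "Q \<in> space (prob_algebra ?S)"
      show "B t x Q $ l - B t x P $ l = (LINT \<alpha>:{0..1}|lborel.
          (\<integral>w. D t x (mix_measure \<alpha> P Q) w \<partial>Q) - (\<integral>w. D t x (mix_measure \<alpha> P Q) w \<partial>P))"
        using diff t x P Q by blast
      show "D t x Q w - D t x P w = (LINT \<alpha>:{0..1}|lborel.
          (\<integral>w'. D2 t x (mix_measure \<alpha> P Q) w w' \<partial>Q) - (\<integral>w'. D2 t x (mix_measure \<alpha> P Q) w w' \<partial>P))"
        if "w \<in> space ?S" for w
        using diff t x P Q that unfolding space_path_space by blast
    qed
    then show ?thesis by blast
  qed
  moreover have "0 < \<bar>K0\<bar> + 1"
    by linarith
  ultimately show thesis
    by (intro that[of "\<bar>K0\<bar> + 1"])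
qed

theorem proposition4p8:
  fixes c :: "real \<Rightarrow> (real^'d) path \<Rightarrow> real^'d"
    and A :: "real \<Rightarrow> (real^'d) path \<Rightarrow> real^'m^'d"
    and B :: "real \<Rightarrow> (real^'d) path \<Rightarrow> (real^'d) path measure \<Rightarrow> real^'m"
  assumes "path_coefficient c" and "path_coefficient A" and "path_law_coefficient B"
    and "assumption_A1 c A B" and "assumption_A2 c A B"
    and "bounded_second_flat_derivative B"
  shows "\<exists>\<beta>::real. 0 < \<beta> \<and>
    (\<forall>\<mu>0\<in>space (prob_algebra (borel :: (real^'d) measure)).
     \<forall>T0 T \<delta> :: real. \<forall>p N i :: nat.
     \<forall>(M :: 'w measure) (F :: real \<Rightarrow> 'w measure)
      (W :: nat \<Rightarrow> 'w \<Rightarrow> (real^'m) path) (X :: nat \<Rightarrow> 'w \<Rightarrow> (real^'d) path).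
       0 < T0 \<and> T0 < T \<and> 0 < \<delta> \<and> 1 \<le> p \<and> 1 \<le> N \<and> i \<in> {1..N} \<and>
       limit_system c A B \<mu>0 T N M F W X \<longrightarrow>
       (\<integral>\<^sup>+\<omega>. (\<integral>\<^sup>+t\<in>{T0..min (T0 + \<delta>) T}. ennreal ((norm (delta_B B M N X i t \<omega>))\<^sup>2) \<partial>lborel) ^ p \<partial>M)
         \<le> ennreal (fact p * \<beta> ^ p * \<delta> ^ p / real N ^ p))"
proof -
  obtain K where K: "0 < K" and flat: "\<And>T l. 0 < T \<Longrightarrow> \<exists>D D2. \<forall>t\<in>{0..T}. \<forall>x\<in>paths {0..T}.
      second_flat_derivative (path_space {0..T}) (\<lambda>Q. B t x Q $ l) (D t x) (D2 t x) K"
    using second_flat_derivative_coefficient[OF assms(3,6)] by blast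
  define \<beta> where "\<beta> = real CARD('m) * (8 * exp 8 * K\<^sup>2)"
  show ?thesis
  proof (intro exI[of _ \<beta>] conjI ballI allI impI)
    show "0 < \<beta>"
      using K by (simp add: \<beta>_def)
    fix \<mu>0 and T0 T \<delta> :: real and p N i :: nat and M :: "'w measure" and F :: "real \<Rightarrow> 'w measure"
      and W :: "nat \<Rightarrow> 'w \<Rightarrow> (real^'m) path" and X :: "nat \<Rightarrow> 'w \<Rightarrow> (real^'d) path"
    assume *: "0 < T0 \<and> T0 < T \<and> 0 < \<delta> \<and> 1 \<le> p \<and> 1 \<le> N \<and> i \<in> {1..N} \<and>
       limit_system c A B \<mu>0 T N M F W X"
    then have i: "i \<in> {1..N}" and sys: "limit_system c A B \<mu>0 T N M F W X" by auto
    have sol: "mckean_solution c A B \<mu>0 T M F (W j) (X j)" if "j \<in> {1..N}" for j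
      using sys that by (auto simp: limit_system_def)
    have "(\<integral>\<^sup>+\<omega>. (\<integral>\<^sup>+t\<in>{T0..min (T0 + \<delta>) T}. ennreal ((norm (delta_B B M N X i t \<omega>))\<^sup>2) \<partial>lborel) ^ p \<partial>M)
        \<le> ennreal (\<delta> ^ p * real CARD('m) ^ p * (fact p * (8 * exp 8 * K\<^sup>2 / real N) ^ p))"
    proof (rule delta_B_moment_le[OF assms(3) K, of T])
      show "prob_space M"
        using sol[OF i] by (simp add: mckean_solution_def filtered_prob_space_def)
      show "X j \<in> M \<rightarrow>\<^sub>M path_space {0..T}" if "j \<in> {1..N}" for j
        using sol[OF that] by (simp add: mckean_solution_def continuous_adapted_def)
      show "distr M (path_space {0..T}) (X j) = distr M (path_space {0..T}) (X i)" if "j \<in> {1..N}" for j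
        using sys i that unfolding limit_system_def by blast
      show "prob_space.indep_vars M (\<lambda>_. path_space {0..T}) X {1..N}"
        using sys by (simp add: limit_system_def)
    qed (use * flat in auto)
    also have "\<delta> ^ p * real CARD('m) ^ p * (fact p * (8 * exp 8 * K\<^sup>2 / real N) ^ p) =
        fact p * \<beta> ^ p * \<delta> ^ p / real N ^ p"
      by (simp add: \<beta>_def power_mult_distrib power_divide)
    finally show "(\<integral>\<^sup>+\<omega>. (\<integral>\<^sup>+t\<in>{T0..min (T0 + \<delta>) T}. ennreal ((norm (delta_B B M N X i t \<omega>))\<^sup>2) \<partial>lborel) ^ p \<partial>M)
         \<le> ennreal (fact p * \<beta> ^ p * \<delta> ^ p / real N ^ p)" .
  qed
qed

end
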